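(* Let $A$ be a finite abelian group of even order and exponent at least $3$, let $y\in A$ have order $2$, and let $G=\mathrm{Dic}(A,y)=\langle A,x \mid x^2=y,\ xax^{-1}=a^{-1}\ (a\in A)\rangle$. Let $S\subseteq G$ with $1\notin S$, $S^{-1}=S$ and $\langle S\rangle=G$. Then $\mathrm{Cay}(G,S)$ is distance integral if and only if $(A,\ell_S)\in C(A)$ and $|\pi(A,\ell_S(x\cdot))|\in\mathbb{Z}$ for every irreducible (i.e. one-dimensional) representation $\pi:A\to\mathbb{C}^*$ with $A^2\not\subseteq\ker(\pi)$.
   Context: $\ell_S:G\to\mathbb{N}$ is defined by $\ell_S(1)=0$ and, for $g\ne1$, $\ell_S(g)$ is the least $n\ge1$ such that $g=x_1\cdots x_n$ with $x_i\in S$. $\ell_S(x\cdot):A\to\mathbb{N}$ is $a\mapsto\ell_S(xa)$. $(A,\ell_S)$ denotes the multi-set with underlying set $A$ and multiplicity function $\ell_S|_A$. A multi-set is a pair $(T,f)$ with $f:T\to\mathbb{N}$; for $\kappa:T\to\mathbb{C}$, $\kappa(T,f)=\sum_{t\in T}f(t)\kappa(t)$. The sum $(T_1,f_1)+(T_2,f_2)$ is $(T_1\cup T_2,f)$ where $f(t)=\tilde f_1(t)+\tilde f_2(t)$, $\tilde f_i$ extending $f_i$ by $0$. For $g\in A$, the atom $[g]=\{a\in A:\langle a\rangle=\langle g\rangle\}$. $C(A)$ is the set of multi-sets of the form $\sum_{[a]\in T}([a],f_a)$ where $T$ is a set of atoms of $A$ and each $f_a:[a]\to\mathbb{N}$ is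 constant. $A^2=\{a^2:a\in A\}$. The Cayley graph $\mathrm{Cay}(G,S)$ has vertex set $G$ and edges $\{g,h\}$ with $g^{-1}h\in S$; a connected graph is distance integral if all eigenvalues of its distance matrix are integers. *)

theory Defs
  imports Complex_Main "HOL-Algebra.Algebra" "Graph_Theory.Graph_Theory"
begin

section \<open>Generalized dicyclic groups\<close>

text \<open>
  Normal-form model of \<open>\<langle>A, x | x\<^sup>2 = y, x a x\<^sup>-\<^sup>1 = a\<^sup>-\<^sup>1 (a \<in> A)\<rangle>\<close>: the pair \<open>(a, False)\<close>
  stands for \<open>a\<close> and \<open>(a, True)\<close> for \<open>x a\<close>. The product is read off from \<open>a x = x a\<^sup>-\<^sup>1\<close>.
  The lemmas \<open>group_Dic\<close>, \<open>Dic_relations\<close>, \<open>generate_Dic\<close>, \<open>Dic_universal\<close> and \<open>Dic_unique\<close>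
  below show that this is the group defined by the presentation.
\<close>

fun dic_mult :: "('a, 'b) monoid_scheme \<Rightarrow> 'a \<Rightarrow> 'a \<times> bool \<Rightarrow> 'a \<times> bool \<Rightarrow> 'a \<times> bool" where
  "dic_mult A y (a, False) (b, False) = (a \<otimes>\<^bsub>A\<^esub> b, False)"
| "dic_mult A y (a, False) (b, True) = (inv\<^bsub>A\<^esub> a \<otimes>\<^bsub>A\<^esub> b, True)"
| "dic_mult A y (a, True) (b, False) = (a \<otimes>\<^bsub>A\<^esub> b, True)"
| "dic_mult A y (a, True) (b, True) = (y \<otimes>\<^bsub>A\<^esub> (inv\<^bsub>A\<^esub> a \<otimes>\<^bsub>A\<^esub> b), False)"

definition Dic :: "('a, 'b) monoid_scheme \<Rightarrow> 'a \<Rightarrow> ('a \<times> bool) monoid" where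
  "Dic A y = \<lparr>carrier = carrier A \<times> UNIV, monoid.mult = dic_mult A y, one = (\<one>\<^bsub>A\<^esub>, False)\<rparr>"

definition dic_emb :: "'a \<Rightarrow> 'a \<times> bool" where
  "dic_emb a = (a, False)"

definition dic_x :: "('a, 'b) monoid_scheme \<Rightarrow> 'a \<times> bool" where
  "dic_x A = (\<one>\<^bsub>A\<^esub>, True)"

context comm_group
begin

lemma group_Dic:
  assumes y: "y \<in> carrier G" "y \<otimes> y = \<one>"
  shows "group (Dic G y)"
proof (rule groupI)
  have iy: "inv y = y"
    using y by (simp add: inv_equality)
  fix g h k
  assume g: "g \<in> carrier (Dic G y)" and h: "h \<in> carrier (Dic G y)"
  obtain a p where [simp]: "g = (a, p)" by force
  obtain b q where [simp]: "h = (b, q)" by force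
  have [simp]: "a \<in> carrier G" "b \<in> carrier G"
    using g h by (auto simp: Dic_def)
  show "g \<otimes>\<^bsub>Dic G y\<^esub> h \<in> carrier (Dic G y)"
    using y by (cases p; cases q) (auto simp: Dic_def)
  assume k: "k \<in> carrier (Dic G y)"
  obtain c r where [simp]: "k = (c, r)" by force
  have [simp]: "c \<in> carrier G"
    using k by (auto simp: Dic_def)
  show "(g \<otimes>\<^bsub>Dic G y\<^esub> h) \<otimes>\<^bsub>Dic G y\<^esub> k = g \<otimes>\<^bsub>Dic G y\<^esub> (h \<otimes>\<^bsub>Dic G y\<^esub> k)"
    using y iy by (cases p; cases q; cases r) (auto simp: Dic_def inv_mult m_ac)
next
  show "\<one>\<^bsub>Dic G y\<^esub> \<in> carrier (Dic G y)"
    by (simp add: Dic_def)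
next
  fix g assume g: "g \<in> carrier (Dic G y)"
  obtain a p where [simp]: "g = (a, p)" by force
  have [simp]: "a \<in> carrier G"
    using g by (auto simp: Dic_def)
  show "\<one>\<^bsub>Dic G y\<^esub> \<otimes>\<^bsub>Dic G y\<^esub> g = g"
    by (cases p) (auto simp: Dic_def)
  show "\<exists>h\<in>carrier (Dic G y). h \<otimes>\<^bsub>Dic G y\<^esub> g = \<one>\<^bsub>Dic G y\<^esub>"
  proof (cases p)
    case True
    then show ?thesis
      using y by (intro bexI[of _ "(y \<otimes> a, True)"]) (simp_all add: Dic_def inv_mult m_assoc)
  next
    case False
    then show ?thesis
      by (intro bexI[of _ "(inv a, False)"]) (simp_all add: Dic_def)
  qed
qed

lemma dic_emb_hom: "dic_emb \<in> hom G (Dic G y)"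
  by (auto simp: hom_def Dic_def dic_emb_def)

lemma inj_dic_emb: "inj dic_emb"
  by (auto simp: inj_def dic_emb_def)

lemma Dic_normal_form:
  "a \<in> carrier G \<Longrightarrow> dic_x G \<otimes>\<^bsub>Dic G y\<^esub> dic_emb a = (a, True)"
  by (simp add: Dic_def dic_x_def dic_emb_def)

lemma Dic_relations:
  assumes y: "y \<in> carrier G" "y \<otimes> y = \<one>"
  shows "dic_x G \<otimes>\<^bsub>Dic G y\<^esub> dic_x G = dic_emb y"
    and "a \<in> carrier G \<Longrightarrow>
      dic_x G \<otimes>\<^bsub>Dic G y\<^esub> dic_emb a \<otimes>\<^bsub>Dic G y\<^esub> inv\<^bsub>Dic G y\<^esub> dic_x G = dic_emb (inv a)"
proof -
  interpret D: group "Dic G y" using y by (rule group_Dic)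
  show "dic_x G \<otimes>\<^bsub>Dic G y\<^esub> dic_x G = dic_emb y"
    using y by (simp add: Dic_def dic_x_def dic_emb_def)
  assume a: "a \<in> carrier G"
  have c: "dic_x G \<in> carrier (Dic G y)" "dic_emb a \<in> carrier (Dic G y)"
    "dic_emb (inv a) \<in> carrier (Dic G y)"
    using a by (auto simp: Dic_def dic_x_def dic_emb_def)
  have "dic_x G \<otimes>\<^bsub>Dic G y\<^esub> dic_emb a = dic_emb (inv a) \<otimes>\<^bsub>Dic G y\<^esub> dic_x G"
    using a by (simp add: Dic_def dic_x_def dic_emb_def)
  then show "dic_x G \<otimes>\<^bsub>Dic G y\<^esub> dic_emb a \<otimes>\<^bsub>Dic G y\<^esub> inv\<^bsub>Dic G y\<^esub> dic_x G = dic_emb (inv a)"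
    using c by (simp add: D.m_assoc)
qed

lemma generate_Dic:
  assumes y: "y \<in> carrier G" "y \<otimes> y = \<one>"
  shows "generate (Dic G y) (insert (dic_x G) (dic_emb ` carrier G)) = carrier (Dic G y)"
    (is "generate ?D ?X = _")
proof
  interpret D: group "Dic G y" using y by (rule group_Dic)
  have "?X \<subseteq> carrier ?D"
    by (auto simp: Dic_def dic_x_def dic_emb_def)
  then show "generate ?D ?X \<subseteq> carrier ?D"
    by (rule D.generate_incl)
  show "carrier ?D \<subseteq> generate ?D ?X"
  proof
    fix g assume g: "g \<in> carrier ?D"
    obtain a p where gp: "g = (a, p)" by force
    have a: "a \<in> carrier G" using g gp by (auto simp: Dic_def)
    have 1: "dic_emb a \<in> generate ?D ?X"
      using a by (intro generate.incl) auto
    have "dic_x G \<otimes>\<^bsub>?D\<^esub> dic_emb a \<in> generate ?D ?X"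
      by (rule generate.eng[OF generate.incl 1]) auto
    then show "g \<in> generate ?D ?X"
      using 1 a gp by (cases p) (simp_all add: Dic_normal_form, simp add: dic_emb_def)
  qed
qed

lemma Dic_universal:
  assumes y: "y \<in> carrier G" "y \<otimes> y = \<one>"
    and H: "group H" and \<phi>: "\<phi> \<in> hom G H" and h: "h \<in> carrier H"
    and rel1: "h \<otimes>\<^bsub>H\<^esub> h = \<phi> y"
    and rel2: "\<And>a. a \<in> carrier G \<Longrightarrow> h \<otimes>\<^bsub>H\<^esub> \<phi> a \<otimes>\<^bsub>H\<^esub> inv\<^bsub>H\<^esub> h = inv\<^bsub>H\<^esub> \<phi> a"
  shows "\<exists>\<psi>\<in>hom (Dic G y) H. (\<forall>a\<in>carrier G. \<psi> (dic_emb a) = \<phi> a) \<and> \<psi> (dic_x G) = h"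
proof -
  interpret H: group H by (rule H)
  interpret P: group_hom G H \<phi>
    using \<phi> by unfold_locales
  have sw: "\<phi> a \<otimes>\<^bsub>H\<^esub> h = h \<otimes>\<^bsub>H\<^esub> inv\<^bsub>H\<^esub> \<phi> a" if a: "a \<in> carrier G" for a
  proof -
    have "h \<otimes>\<^bsub>H\<^esub> \<phi> (inv a) = (h \<otimes>\<^bsub>H\<^esub> \<phi> (inv a) \<otimes>\<^bsub>H\<^esub> inv\<^bsub>H\<^esub> h) \<otimes>\<^bsub>H\<^esub> h"
      using a h by (simp add: H.m_assoc)
    also have "\<dots> = \<phi> a \<otimes>\<^bsub>H\<^esub> h"
      using a h by (subst rel2) auto
    finally show ?thesis using a by simp
  qed
  define \<psi> where "\<psi> = (\<lambda>(a, p). if p then h \<otimes>\<^bsub>H\<^esub> \<phi> a else \<phi> a)"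
  have sw': "\<phi> a \<otimes>\<^bsub>H\<^esub> (h \<otimes>\<^bsub>H\<^esub> z) = h \<otimes>\<^bsub>H\<^esub> (inv\<^bsub>H\<^esub> \<phi> a \<otimes>\<^bsub>H\<^esub> z)"
    if "a \<in> carrier G" "z \<in> carrier H" for a z
    using that h sw[of a] by (simp flip: H.m_assoc)
  have rel1': "h \<otimes>\<^bsub>H\<^esub> (h \<otimes>\<^bsub>H\<^esub> z) = \<phi> y \<otimes>\<^bsub>H\<^esub> z" if "z \<in> carrier H" for z
    using that h rel1 by (simp flip: H.m_assoc)
  have "\<psi> \<in> hom (Dic G y) H"
  proof (rule homI)
    fix g assume "g \<in> carrier (Dic G y)"
    then show "\<psi> g \<in> carrier H"
      using h by (auto simp: \<psi>_def Dic_def)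
  next
    fix g k assume g: "g \<in> carrier (Dic G y)" and k: "k \<in> carrier (Dic G y)"
    obtain a p where [simp]: "g = (a, p)" by force
    obtain b q where [simp]: "k = (b, q)" by force
    have [simp]: "a \<in> carrier G" "b \<in> carrier G"
      using g k by (auto simp: Dic_def)
    show "\<psi> (g \<otimes>\<^bsub>Dic G y\<^esub> k) = \<psi> g \<otimes>\<^bsub>H\<^esub> \<psi> k"
      using y h by (cases p; cases q) (auto simp: \<psi>_def Dic_def H.m_assoc sw' rel1')
  qed
  moreover have "\<psi> (dic_emb a) = \<phi> a" for a
    by (simp add: \<psi>_def dic_emb_def)
  moreover have "\<psi> (dic_x G) = h"
    using h by (simp add: \<psi>_def dic_x_def)
  ultimately show ?thesis by blast
qed

lemma Dic_unique:
  assumes \<psi>: "\<psi> \<in> hom (Dic G y) H" and \<psi>': "\<psi>' \<in> hom (Dic G y) H"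
    and eq: "\<And>a. a \<in> carrier G \<Longrightarrow> \<psi> (dic_emb a) = \<psi>' (dic_emb a)" "\<psi> (dic_x G) = \<psi>' (dic_x G)"
    and g: "g \<in> carrier (Dic G y)"
  shows "\<psi> g = \<psi>' g"
proof -
  obtain a p where gp: "g = (a, p)" by force
  have a: "a \<in> carrier G" using g gp by (auto simp: Dic_def)
  have c: "dic_x G \<in> carrier (Dic G y)" "dic_emb a \<in> carrier (Dic G y)"
    using a by (auto simp: Dic_def dic_x_def dic_emb_def)
  show ?thesis
  proof (cases p)
    case True
    then have "g = dic_x G \<otimes>\<^bsub>Dic G y\<^esub> dic_emb a"
      using a gp by (simp add: Dic_normal_form)
    then show ?thesis
      using c eq a hom_mult[OF \<psi> c] hom_mult[OF \<psi>' c] by simp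
  next
    case False
    then show ?thesis using eq(1)[OF a] gp by (simp add: dic_emb_def)
  qed
qed

end


section \<open>Group-theoretic notions\<close>

definition group_exponent :: "('a, 'b) monoid_scheme \<Rightarrow> nat" where
  "group_exponent G = (LEAST n. 0 < n \<and> (\<forall>a\<in>carrier G. a [^]\<^bsub>G\<^esub> n = \<one>\<^bsub>G\<^esub>))"

definition word_length :: "('a, 'b) monoid_scheme \<Rightarrow> 'a set \<Rightarrow> 'a \<Rightarrow> nat" where
  "word_length G S g =
    (if g = \<one>\<^bsub>G\<^esub> then 0
     else (LEAST n. 1 \<le> n \<and>
       (\<exists>xs. length xs = n \<and> set xs \<subseteq> S \<and> g = foldr (\<otimes>\<^bsub>G\<^esub>) xs \<one>\<^bsub>G\<^esub>)))"

definition complex_units :: "complex monoid" where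
  "complex_units = \<lparr>carrier = UNIV - {0}, monoid.mult = (*), one = 1\<rparr>"

definition group_squares :: "('a, 'b) monoid_scheme \<Rightarrow> 'a set" where
  "group_squares A = {a \<otimes>\<^bsub>A\<^esub> a |a. a \<in> carrier A}"

definition atom :: "('a, 'b) monoid_scheme \<Rightarrow> 'a \<Rightarrow> 'a set" where
  "atom A g = {a \<in> carrier A. generate A {a} = generate A {g}}"

definition atoms :: "('a, 'b) monoid_scheme \<Rightarrow> 'a set set" where
  "atoms A = atom A ` carrier A"


section \<open>Multi-sets with an explicit underlying set\<close>

text \<open>
  The library's \<open>multiset\<close> type forgets elements of multiplicity \<open>0\<close>, whereas here the
  underlying set is part of the data. A pair \<open>(T, f)\<close> with \<open>f : T \<rightarrow> \<nat>\<close> is represented with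
  \<open>f\<close> extensional (\<open>undefined\<close> outside \<open>T\<close>), so that equality of pairs is the intended one.
\<close>

type_synonym 'a mset_pair = "'a set \<times> ('a \<Rightarrow> nat)"

definition mk_mset :: "'a set \<Rightarrow> ('a \<Rightarrow> nat) \<Rightarrow> 'a mset_pair" where
  "mk_mset T f = (T, restrict f T)"

definition mset_mult :: "'a mset_pair \<Rightarrow> 'a \<Rightarrow> nat" where
  "mset_mult M t = (if t \<in> fst M then snd M t else 0)"

definition mset_plus :: "'a mset_pair \<Rightarrow> 'a mset_pair \<Rightarrow> 'a mset_pair" where
  "mset_plus M N = mk_mset (fst M \<union> fst N) (\<lambda>t. mset_mult M t + mset_mult N t)"

definition mset_sum :: "('i \<Rightarrow> 'a mset_pair) \<Rightarrow> 'i set \<Rightarrow> 'a mset_pair" where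
  "mset_sum M I = mk_mset (\<Union>i\<in>I. fst (M i)) (\<lambda>t. \<Sum>i\<in>I. mset_mult (M i) t)"

lemma mset_sum_insert:
  assumes "finite I" "i \<notin> I"
  shows "mset_sum M (insert i I) = mset_plus (M i) (mset_sum M I)"
  using assms
  by (auto simp: mset_sum_def mset_plus_def mk_mset_def mset_mult_def restrict_def fun_eq_iff
      intro!: sum.neutral)

lemma mset_sum_singleton: "mset_sum (\<lambda>i. mk_mset (T i) (f i)) {i} = mk_mset (T i) (f i)"
  by (auto simp: mset_sum_def mk_mset_def mset_mult_def)

definition mset_eval :: "('a \<Rightarrow> complex) \<Rightarrow> 'a mset_pair \<Rightarrow> complex" where
  "mset_eval \<kappa> M = (\<Sum>t\<in>fst M. of_nat (snd M t) * \<kappa> t)"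

definition atomic_msets :: "('a, 'b) monoid_scheme \<Rightarrow> 'a mset_pair set" where
  "atomic_msets A =
    {mset_sum (\<lambda>\<alpha>. mk_mset \<alpha> (f \<alpha>)) T |T f.
       T \<subseteq> atoms A \<and> (\<forall>\<alpha>\<in>T. \<exists>c. \<forall>a\<in>\<alpha>. f \<alpha> a = c)}"


section \<open>Cayley graphs and distance integrality\<close>

text \<open>
  An undirected graph is represented as a symmetric digraph, as in the
  graph theory library; \<open>cayley_graph G S\<close> is symmetric and loop-free when \<open>S = S\<^sup>-\<^sup>1\<close> and \<open>1 \<notin> S\<close>.
\<close>

definition cayley_graph :: "('a, 'b) monoid_scheme \<Rightarrow> 'a set \<Rightarrow> 'a pair_pre_digraph" where
  "cayley_graph G S =
    \<lparr>pverts = carrier G,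
     parcs = {(g, h). g \<in> carrier G \<and> h \<in> carrier G \<and> inv\<^bsub>G\<^esub> g \<otimes>\<^bsub>G\<^esub> h \<in> S}\<rparr>"

definition graph_dist :: "('v, 'e) pre_digraph \<Rightarrow> 'v \<Rightarrow> 'v \<Rightarrow> nat" where
  "graph_dist \<Gamma> u v = (LEAST n. \<exists>p. pre_digraph.awalk \<Gamma> u p v \<and> length p = n)"

text \<open>Eigenvalues of a square matrix whose rows and columns are indexed by the finite set \<open>V\<close>.\<close>

definition is_eigenvalue :: "'v set \<Rightarrow> ('v \<Rightarrow> 'v \<Rightarrow> complex) \<Rightarrow> complex \<Rightarrow> bool" where
  "is_eigenvalue V M \<mu> \<longleftrightarrow>
    (\<exists>f. (\<exists>v\<in>V. f v \<noteq> 0) \<and> (\<forall>u\<in>V. (\<Sum>v\<in>V. M u v * f v) = \<mu> * f u))"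

definition distance_matrix :: "('v, 'e) pre_digraph \<Rightarrow> 'v \<Rightarrow> 'v \<Rightarrow> complex" where
  "distance_matrix \<Gamma> u v = of_nat (graph_dist \<Gamma> u v)"

definition distance_integral :: "('v, 'e) pre_digraph \<Rightarrow> bool" where
  "distance_integral \<Gamma> \<longleftrightarrow>
    Digraph_Component.connected \<Gamma> \<and>
    (\<forall>\<mu>. is_eigenvalue (verts \<Gamma>) (distance_matrix \<Gamma>) \<mu> \<longrightarrow> \<mu> \<in> \<int>)"

end

theory Submission
  imports "Jordan_Normal_Form.Char_Poly" "HOL-Number_Theory.Cong" Defs
begin

text \<open>
  Write \<open>L a = \<ell>(a)\<close>, \<open>M a = \<ell>(x a)\<close> and let \<open>\<pi>\<close> range over the characters of \<open>A\<close>. The distance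
  matrix preserves the span of \<open>(\<pi>, 0)\<close> and \<open>(0, \<pi>\<^sup>-\<^sup>1)\<close>, and its eigenvalues there are
  \<open>\<pi>(L) \<plusminus> \<bar>\<pi>(M)\<bar>\<close>; as the characters are complete, these are all eigenvalues.

  If \<open>L\<close> is constant on atoms, every \<open>\<pi>(L)\<close> is an integer: an atom is a cyclic subgroup minus
  smaller atoms, and \<open>\<pi>\<close> sums to \<open>0\<close> or to the order over a subgroup. If \<open>\<pi>\<close> is trivial on squares, it
  takes the values \<open>1\<close> and \<open>-1\<close>, so \<open>\<pi>(M)\<close> is an integer as well.

  Conversely, if all \<open>\<pi>(L) \<plusminus> \<bar>\<pi>(M)\<bar>\<close> are integers, then \<open>\<pi>(L)\<close> is a rational algebraic integer.
  For a prime \<open>p\<close> the Frobenius congruence gives \<open>\<pi>\<^sup>p(L) \<equiv> \<pi>(L)\<close> modulo \<open>p\<close>, and for large \<open>p\<close> this is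
  an equality because both sides are bounded. Two generators \<open>a\<close>, \<open>b\<close> of the same cyclic group satisfy
  \<open>b = a\<^sup>k\<close> where, by the Chinese remainder theorem, all prime factors of \<open>k\<close> may be taken large; hence
  \<open>\<pi>\<^sup>k(L) = \<pi>(L)\<close> for all \<open>\<pi>\<close>, and completeness yields \<open>L a = L b\<close>. No irreducibility of cyclotomic
  polynomials and no theorem on primes in progressions is needed.
\<close>

section \<open>Arithmetic preliminaries\<close>

text \<open>Numbering \<open>I\<close> turns \<open>c\<close> into an integer matrix with
  eigenvector \<open>v\<close> for \<open>z\<close>. So \<open>z\<close> is a root of its
  characteristic polynomial, which is monic with integer coefficients.\<close>

lemma algebraic_int_eigenvalue:
  fixes z :: complex and v :: "'i \<Rightarrow> complex" and c :: "'i \<Rightarrow> 'i \<Rightarrow> int"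
  assumes I: "finite I" and i: "i \<in> I" "v i \<noteq> 0"
    and eq: "\<And>j. j \<in> I \<Longrightarrow> z * v j = (\<Sum>k\<in>I. of_int (c j k) * v k)"
  shows "algebraic_int z"
proof -
  define n where "n = card I"
  obtain e where e: "bij_betw e {..<n} I"
    using ex_bij_betw_nat_finite[OF I] by (auto simp: n_def atLeast0LessThan)
  define C where "C = mat n n (\<lambda>(j, k). c (e j) (e k))"
  have C: "C \<in> carrier_mat n n" by (simp add: C_def)
  let ?C = "map_mat of_int C :: complex mat"
  have C': "?C \<in> carrier_mat n n" using C by simp
  define w where "w = vec n (v \<circ> e)"
  obtain i' where i': "i' < n" "e i' = i"
    using e i(1) by (auto simp: bij_betw_def)
  have "eigenvector ?C w z"
    unfolding eigenvector_def
  proof (intro conjI)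
    show "w \<in> carrier_vec (dim_row ?C)" using C by (auto simp: w_def)
    have "w $ i' \<noteq> 0" using i i' by (simp add: w_def)
    then show "w \<noteq> 0\<^sub>v (dim_row ?C)" using i' C by auto
    show "?C *\<^sub>v w = z \<cdot>\<^sub>v w"
    proof (rule eq_vecI)
      fix j assume "j < dim_vec (z \<cdot>\<^sub>v w)"
      then have j: "j < n" by (simp add: w_def)
      then have ej: "e j \<in> I" using e by (auto simp: bij_betw_def)
      have "(?C *\<^sub>v w) $ j = (\<Sum>k<n. of_int (c (e j) (e k)) * v (e k))"
        using j by (simp add: C_def w_def scalar_prod_def atLeast0LessThan)
      also have "\<dots> = (\<Sum>k\<in>I. of_int (c (e j) k) * v k)"
        by (rule sum.reindex_bij_betw[OF e])
      finally show "(?C *\<^sub>v w) $ j = (z \<cdot>\<^sub>v w) $ j"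
        using j eq[OF ej] by (simp add: w_def)
    qed (use C in \<open>simp add: w_def\<close>)
  qed
  then have "poly (char_poly ?C) z = 0"
    using eigenvalue_root_char_poly[OF C'] by (auto simp: eigenvalue_def)
  then have "poly (map_poly of_int (char_poly C)) z = 0"
    by (simp add: of_int_hom.char_poly_hom[OF C])
  moreover have "Polynomial.lead_coeff (char_poly C) = 1"
    using degree_monic_char_poly[OF C] by simp
  ultimately show ?thesis
    by (auto simp: algebraic_int_altdef_ipoly)
qed

text \<open>The inner binomial coefficients are divisible by \<open>p\<close>. The set
  \<open>R\<close> stands for a subring of the complex numbers: below it is the integers or the ring
  of values of a character. The error term must stay in \<open>R\<close>, since divisibility by
  \<open>p\<close> is meant there.\<close>

lemma prime_power_add:
  fixes R :: "complex set" and p :: nat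
  assumes p: "Factorial_Ring.prime p"
    and int: "\<And>m. of_int m \<in> R"
    and add: "\<And>x y. x \<in> R \<Longrightarrow> y \<in> R \<Longrightarrow> x + y \<in> R"
    and mult: "\<And>x y. x \<in> R \<Longrightarrow> y \<in> R \<Longrightarrow> x * y \<in> R"
    and x: "x \<in> R" "y \<in> R"
  shows "\<exists>w\<in>R. (x + y) ^ p = x ^ p + y ^ p + of_nat p * w"
proof -
  have R0: "0 \<in> R" using int[of 0] by simp
  have R1: "1 \<in> R" using int[of 1] by simp
  have nat: "of_nat n \<in> R" for n using int[of "int n"] by simp
  have pow: "z ^ k \<in> R" if "z \<in> R" for z k
    using that by (induction k) (auto intro: mult R1)
  have sum: "sum f I \<in> R" if "\<And>i. i \<in> I \<Longrightarrow> f i \<in> R" for f and I :: "nat set"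
    using that by (induction I rule: infinite_finite_induct) (auto intro: add R0)
  define c where "c = (\<lambda>k. of_nat ((p choose k) div p) * x ^ k * y ^ (p - k))"
  have p2: "2 \<le> p" using p by (rule prime_ge_2_nat)
  have split: "{..p} = insert 0 (insert p {1..<p})" using p2 by auto
  have c: "of_nat (p choose k) * x ^ k * y ^ (p - k) = of_nat p * c k" if "k \<in> {1..<p}" for k
  proof -
    have "p dvd p choose k" using that p by (intro dvd_choose_prime) auto
    then have "p choose k = p * ((p choose k) div p)" by simp
    then have "of_nat (p choose k) = (of_nat p * of_nat ((p choose k) div p) :: complex)"
      by (metis of_nat_mult)
    then show ?thesis by (simp add: c_def)
  qed
  have "(x + y) ^ p = (\<Sum>k\<le>p. of_nat (p choose k) * x ^ k * y ^ (p - k))"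
    by (rule binomial_ring)
  also have "\<dots> = y ^ p + x ^ p + (\<Sum>k\<in>{1..<p}. of_nat (p choose k) * x ^ k * y ^ (p - k))"
    using p2 unfolding split by (simp add: add.assoc)
  also have "(\<Sum>k\<in>{1..<p}. of_nat (p choose k) * x ^ k * y ^ (p - k)) = of_nat p * (\<Sum>k\<in>{1..<p}. c k)"
    unfolding sum_distrib_left by (rule sum.cong[OF refl]) (rule c)
  finally have "(x + y) ^ p = x ^ p + y ^ p + of_nat p * (\<Sum>k\<in>{1..<p}. c k)" by simp
  moreover have "(\<Sum>k\<in>{1..<p}. c k) \<in> R"
    unfolding c_def by (intro sum mult nat pow x)
  ultimately show ?thesis by blast
qed

lemma prime_power_sum:
  fixes R :: "complex set" and p :: nat
  assumes p: "Factorial_Ring.prime p"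
    and int: "\<And>m. of_int m \<in> R"
    and add: "\<And>x y. x \<in> R \<Longrightarrow> y \<in> R \<Longrightarrow> x + y \<in> R"
    and mult: "\<And>x y. x \<in> R \<Longrightarrow> y \<in> R \<Longrightarrow> x * y \<in> R"
    and I: "finite I" "\<And>i. i \<in> I \<Longrightarrow> x i \<in> R"
  shows "\<exists>w\<in>R. (\<Sum>i\<in>I. x i) ^ p = (\<Sum>i\<in>I. x i ^ p) + of_nat p * w"
  using I
proof (induction I)
  case empty
  then show ?case using p int[of 0] by (auto simp: prime_gt_0_nat intro!: bexI[of _ 0])
next
  case (insert i I)
  then obtain w where w: "w \<in> R" "(\<Sum>i\<in>I. x i) ^ p = (\<Sum>i\<in>I. x i ^ p) + of_nat p * w" by auto
  have R0: "0 \<in> R" using int[of 0] by simp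
  have "(\<Sum>i\<in>I. x i) \<in> R"
    using insert.hyps(1) insert.prems by (induction I) (auto intro: add R0)
  then obtain v where v: "v \<in> R"
    "(x i + (\<Sum>i\<in>I. x i)) ^ p = x i ^ p + (\<Sum>i\<in>I. x i) ^ p + of_nat p * v"
    using prime_power_add[of p R "x i" "\<Sum>i\<in>I. x i"] p int add mult insert.prems by auto
  then show ?case using w insert.hyps add[OF w(1) v(1)]
    by (intro bexI[of _ "w + v"]) (auto simp: algebra_simps)
qed

lemma fermat_little_int:
  fixes a :: int and p :: nat
  assumes p: "Factorial_Ring.prime p"
  shows "int p dvd a ^ p - a"
proof -
  have nat: "int p dvd int n ^ p - int n" for n
  proof -
    \<comment> \<open>As \<open>n\<close> is a sum of \<open>n\<close> ones, the congruence for
      power sums, taken over the integers, is Fermat's theorem for natural numbers.\<close>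
    obtain w :: complex where w: "w \<in> \<int>" "(\<Sum>i<n. 1) ^ p = (\<Sum>i<n. 1 ^ p) + of_nat p * w"
      using prime_power_sum[of p "\<int>" "{..<n}" "\<lambda>_. 1"] p by auto
    then obtain m where "w = of_int m" by (auto elim: Ints_cases)
    with w have "of_int (int n ^ p) = (of_int (int n + int p * m) :: complex)" by simp
    then have "int n ^ p = int n + int p * m" by (simp only: of_int_eq_iff)
    then show ?thesis by simp
  qed
  \<comment> \<open>Passing to the residue modulo \<open>p\<close> reduces an arbitrary integer to a
    natural number.\<close>
  define r where "r = nat (a mod int p)"
  have r: "int r = a mod int p" using p by (simp add: r_def prime_gt_0_nat)
  have 1: "[a = int r] (mod int p)" by (simp add: r cong_def)
  have "[a ^ p = int r ^ p] (mod int p)" using 1 by (rule cong_pow)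
  also have "[int r ^ p = int r] (mod int p)" using nat[of r] by (simp add: cong_iff_dvd_diff)
  also have "[int r = a] (mod int p)" using 1 by (rule cong_sym)
  finally show ?thesis by (simp add: cong_iff_dvd_diff)
qed

text \<open>A prime that divides \<open>m\<close> cannot divide \<open>k'\<close>, which is
  congruent to the unit \<open>k\<close> modulo \<open>m\<close>. The other primes up to
  \<open>N\<close> are excluded by asking that \<open>k'\<close> be 1 modulo their product, which is
  coprime to \<open>m\<close>.\<close>

lemma exists_cong_large_prime_factors:
  fixes k m N :: nat
  assumes "coprime k m" "m > 0"
  shows "\<exists>k'>0. [k' = k] (mod m) \<and> (\<forall>p. Factorial_Ring.prime p \<longrightarrow> p dvd k' \<longrightarrow> p > N)"
proof -
  define P where "P = {p. Factorial_Ring.prime p \<and> p \<le> N \<and> \<not> p dvd m}"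
  have P: "finite P" by (rule finite_subset[of _ "{..N}"]) (auto simp: P_def)
  define Q where "Q = \<Prod>P"
  have "coprime m Q"
    unfolding Q_def
    by (intro prod_coprime_right) (auto simp: P_def coprime_commute prime_imp_coprime)
  then obtain x where x: "[x = k] (mod m)" "[x = 1] (mod Q)"
    using binary_chinese_remainder_nat by blast
  have "Q > 0" unfolding Q_def by (rule prod_pos) (auto simp: P_def prime_gt_0_nat)
  \<comment> \<open>The solution \<open>x\<close> may be 0; adding \<open>m * Q\<close> makes it
    positive and keeps both congruences.\<close>
  then have pos: "0 < x + m * Q" using assms by simp
  have 1: "[x + m * Q = k] (mod m)" "[x + m * Q = 1] (mod Q)" using x by (auto simp: cong_def)
  have "p > N" if p: "Factorial_Ring.prime p" "p dvd x + m * Q" for p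
  proof (rule ccontr)
    assume "\<not> p > N"
    show False
    proof (cases "p dvd m")
      case True
      then have "[x + m * Q = k] (mod p)" using 1(1) cong_dvd_modulus_nat by blast
      then have "p dvd k" using p(2) cong_dvd_iff by blast
      then show False using True assms p(1)
        by (metis coprime_common_divisor not_prime_unit)
    next
      case False
      then have "p \<in> P" using p \<open>\<not> p > N\<close> by (auto simp: P_def)
      then have "p dvd Q" unfolding Q_def using P by (rule dvd_prodI[rotated])
      then have "[x + m * Q = 1] (mod p)" using 1(2) cong_dvd_modulus_nat by blast
      then have "p dvd 1" using p(2) cong_dvd_iff by blast
      then show False using p(1) by simp
    qed
  qed
  then show ?thesis using pos 1(1) by blast
qed

lemma sum_roots_of_unity:
  fixes k n :: nat
  assumes "n > 0" "k < n"
  shows "(\<Sum>j<n. cis (2 * pi * real k / real n) ^ j) = (if k = 0 then of_nat n else 0)"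
proof (cases "k = 0")
  case False
  let ?w = "cis (2 * pi * real k / real n)"
  have "?w ^ n = cis (2 * pi * real k)"
    using assms by (simp add: DeMoivre)
  then have "?w ^ n = 1" by (metis cis_multiple_2pi Ints_of_nat)
  moreover have "?w \<noteq> 1"
  proof
    assume "?w = 1"
    then have "cos (2 * pi * real k / real n) = 1"
      by (simp add: complex_eq_iff)
    then obtain m :: int where "2 * pi * real k / real n = real_of_int m * 2 * pi"
      by (auto simp: cos_one_2pi_int)
    then have "real k = real_of_int m * real n" using assms by (simp add: field_simps)
    then have "int k = m * int n" by (metis of_int_eq_iff of_int_mult of_int_of_nat_eq)
    then show False using assms False
      by (metis dvd_triv_right int_dvd_int_iff nat_dvd_not_less neq0_conv)
  qed
  ultimately show ?thesis using False
    by (simp add: geometric_sum)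
qed simp

lemma sum_Times_bool:
  assumes "finite C"
  shows "(\<Sum>v\<in>C \<times> UNIV. f v) = (\<Sum>b\<in>C. f (b, False)) + (\<Sum>b\<in>C. f (b, True))"
proof -
  have "(\<Sum>v\<in>C \<times> UNIV. f v) = (\<Sum>b\<in>C. \<Sum>q\<in>UNIV. f (b, q))"
    by (simp add: sum.cartesian_product)
  then show ?thesis by (simp add: UNIV_bool sum.distrib)
qed

section \<open>Characters of finite abelian groups\<close>

context comm_group
begin

abbreviation characters :: "('a \<Rightarrow> complex) set" where
  "characters \<equiv> hom G complex_units"

abbreviation char_sum :: "('a \<Rightarrow> complex) \<Rightarrow> ('a \<Rightarrow> complex) \<Rightarrow> complex" where
  "char_sum F \<pi> \<equiv> (\<Sum>a\<in>carrier G. F a * \<pi> a)"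

lemma charactersI:
  assumes "\<And>a. a \<in> carrier G \<Longrightarrow> \<pi> a \<noteq> 0"
    and "\<And>a b. a \<in> carrier G \<Longrightarrow> b \<in> carrier G \<Longrightarrow> \<pi> (a \<otimes> b) = \<pi> a * \<pi> b"
  shows "\<pi> \<in> characters"
  using assms by (auto simp: hom_def complex_units_def)

lemma character_mult:
  "\<lbrakk>\<pi> \<in> characters; a \<in> carrier G; b \<in> carrier G\<rbrakk> \<Longrightarrow> \<pi> (a \<otimes> b) = \<pi> a * \<pi> b"
  by (auto simp: hom_def complex_units_def)

lemma character_nonzero: "\<lbrakk>\<pi> \<in> characters; a \<in> carrier G\<rbrakk> \<Longrightarrow> \<pi> a \<noteq> 0"
  by (auto simp: hom_def complex_units_def)

lemma character_one: "\<pi> \<in> characters \<Longrightarrow> \<pi> \<one> = 1"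
  using character_mult[of \<pi> \<one> \<one>] character_nonzero[of \<pi> \<one>] by simp

lemma character_inv:
  assumes "\<pi> \<in> characters" "a \<in> carrier G"
  shows "\<pi> (inv a) = inverse (\<pi> a)"
  using character_mult[of \<pi> a "inv a"] character_one[of \<pi>] assms
  by (simp add: inverse_unique)

lemma character_pow:
  assumes "\<pi> \<in> characters" "a \<in> carrier G"
  shows "\<pi> (a [^] (n::nat)) = \<pi> a ^ n"
  using assms by (induction n) (auto simp: character_one character_mult mult.commute)

lemma character_compose_inv:
  "\<pi> \<in> characters \<Longrightarrow> (\<lambda>a. \<pi> (inv a)) \<in> characters"
  by (intro charactersI) (auto simp: character_nonzero character_mult inv_mult)

lemma character_compose_pow:
  "\<pi> \<in> characters \<Longrightarrow> (\<lambda>a. \<pi> (a [^] (n::nat))) \<in> characters"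
  by (intro charactersI) (auto simp: character_nonzero character_mult pow_mult_distrib m_comm)

lemma norm_character:
  assumes fin: "finite (carrier G)" and "\<pi> \<in> characters" "a \<in> carrier G"
  shows "norm (\<pi> a) = 1"
proof -
  have "\<pi> a ^ order G = 1"
    using assms pow_order_eq_1 by (metis character_one character_pow)
  moreover have "order G > 0" using fin by (simp add: order_gt_0_iff_finite)
  ultimately show ?thesis
    by (metis less_numeral_extra(3) power_eq_1_iff)
qed

lemma character_inv_cnj:
  assumes "finite (carrier G)" and "\<pi> \<in> characters" "a \<in> carrier G"
  shows "\<pi> (inv a) = cnj (\<pi> a)"
proof -
  have "\<pi> a * cnj (\<pi> a) = 1"
    using norm_character[OF assms] by (simp add: complex_norm_square[symmetric])
  then show ?thesis
    using character_inv[OF assms(2,3)] by (simp add: inverse_unique)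
qed

section \<open>Sums over the group under translation and inversion\<close>

lemma inv_cancel_left: "\<lbrakk>a \<in> carrier G; b \<in> carrier G\<rbrakk> \<Longrightarrow> inv a \<otimes> (a \<otimes> b) = b"
  by (simp add: m_assoc[symmetric])

lemma sum_translate:
  assumes "a \<in> carrier G"
  shows "(\<Sum>b\<in>carrier G. h (a \<otimes> b)) = (\<Sum>b\<in>carrier G. h b)"
proof (rule sum.reindex_bij_witness[of _ "\<lambda>b. inv a \<otimes> b" "\<lambda>b. a \<otimes> b"])
qed (use assms in \<open>auto simp: m_assoc[symmetric]\<close>)

lemma sum_inv: "(\<Sum>b\<in>carrier G. h (inv b)) = (\<Sum>b\<in>carrier G. h b)"
  by (rule sum.reindex_bij_witness[of _ "\<lambda>b. inv b" "\<lambda>b. inv b"]) auto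

text \<open>The eigencomponents of \<open>F\<close> under translation by \<open>a\<close> add up to \<open>F\<close>.\<close>

lemma exists_translation_eigenfunction:
  fixes F :: "'a \<Rightarrow> complex"
  assumes fin: "finite (carrier G)" and a: "a \<in> carrier G"
    and b: "b \<in> carrier G" "F b \<noteq> 0"
  obtains \<omega> c where "\<omega> \<noteq> 0"
    "\<exists>d\<in>carrier G. (\<Sum>k < order G. c k * F (d \<otimes> a [^] k)) \<noteq> 0"
    "\<And>d. d \<in> carrier G \<Longrightarrow>
       (\<Sum>k < order G. c k * F (d \<otimes> a \<otimes> a [^] k)) = \<omega> * (\<Sum>k < order G. c k * F (d \<otimes> a [^] k))"
proof -
  define n where "n = order G"
  have n: "n > 0" using fin by (simp add: n_def order_gt_0_iff_finite)
  define z where "z = cis (2 * pi / real n)"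
  have z0: "z \<noteq> 0" by (simp add: z_def)
  have zn: "z ^ n = 1" using n by (simp add: z_def DeMoivre)
  have zk: "z ^ k = cis (2 * pi * real k / real n)" for k
    by (simp add: z_def DeMoivre mult.commute)
  \<comment> \<open>Up to the factor \<open>n\<close>, \<open>E j\<close> is the projection of
    \<open>F\<close> onto the functions that translation by \<open>a\<close> multiplies by
    \<open>inverse (z ^ j)\<close>. Summing over \<open>j\<close> leaves only the term
    \<open>k = 0\<close>, that is, \<open>n\<close> times \<open>F\<close>; hence some
    \<open>E j\<close> does not vanish at \<open>b\<close>.\<close>
  define E where "E = (\<lambda>j d. \<Sum>k<n. z ^ (j * k) * F (d \<otimes> a [^] k))"
  have "(\<Sum>j<n. E j b) = (\<Sum>k<n. F (b \<otimes> a [^] k) * (\<Sum>j<n. (z ^ k) ^ j))"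
    unfolding E_def by (subst sum.swap) (simp add: sum_distrib_left power_mult[symmetric] mult_ac)
  also have "\<dots> = (\<Sum>k<n. if k = 0 then F (b \<otimes> a [^] k) * of_nat n else 0)"
    by (rule sum.cong) (auto simp: zk sum_roots_of_unity[OF n])
  also have "\<dots> = F b * of_nat n"
    using n b by (simp add: sum.delta)
  finally have "(\<Sum>j<n. E j b) \<noteq> 0" using n b by simp
  then obtain j where j: "E j b \<noteq> 0" by (metis sum.neutral)
  show thesis
  proof (rule that[of "inverse (z ^ j)" "\<lambda>k. z ^ (j * k)"])
    show "inverse (z ^ j) \<noteq> 0" using z0 by simp
    show "\<exists>d\<in>carrier G. (\<Sum>k < order G. z ^ (j * k) * F (d \<otimes> a [^] k)) \<noteq> 0"
      using j b unfolding E_def n_def by blast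
    fix d assume d: "d \<in> carrier G"
    define h where "h = (\<lambda>k. z ^ (j * k) * F (d \<otimes> a [^] k))"
    \<comment> \<open>Both factors of \<open>h\<close> have period \<open>n\<close>, so shifting the
      index does not change the sum over one period.\<close>
    have "h n = h 0"
      using pow_order_eq_1[OF a] zn by (simp add: h_def n_def[symmetric] power_mult mult.commute[of j])
    then have cyc: "(\<Sum>k<n. h (Suc k)) = (\<Sum>k<n. h k)"
      using sum.lessThan_Suc_shift[of h n] by (simp add: sum.lessThan_Suc)
    have "(\<Sum>k<n. z ^ (j * k) * F (d \<otimes> a \<otimes> a [^] k)) = (\<Sum>k<n. inverse (z ^ j) * h (Suc k))"
      using z0 a d nat_pow_Suc2[OF a]
      by (intro sum.cong) (auto simp: h_def power_add m_assoc)
    then show "(\<Sum>k < order G. z ^ (j * k) * F (d \<otimes> a \<otimes> a [^] k)) =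
        inverse (z ^ j) * (\<Sum>k < order G. z ^ (j * k) * F (d \<otimes> a [^] k))"
      using cyc by (simp add: sum_distrib_left[symmetric] n_def h_def)
  qed
qed

text \<open>A nonzero function orthogonal to all characters is refined, one group element at a time,
  to a nonzero common eigenfunction \<open>H\<close> of all translations that is still orthogonal to
  them. Such an \<open>H\<close> is a multiple of a character \<open>\<chi>\<close>, and pairing it
  with the inverse of \<open>\<chi>\<close> gives a nonzero value.\<close>

theorem character_completeness:
  fixes F :: "'a \<Rightarrow> complex"
  assumes fin: "finite (carrier G)"
    and zero: "\<And>\<pi>. \<pi> \<in> characters \<Longrightarrow> char_sum F \<pi> = 0"
    and a: "a \<in> carrier G"
  shows "F a = 0"
proof (rule ccontr)
  assume "F a \<noteq> 0"
  have "\<exists>H. (\<exists>b\<in>carrier G. H b \<noteq> 0) \<and> (\<forall>\<pi>\<in>characters. char_sum H \<pi> = 0) \<and>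
      (\<forall>b\<in>B. \<exists>\<omega>. \<omega> \<noteq> 0 \<and> (\<forall>d\<in>carrier G. H (d \<otimes> b) = \<omega> * H d))"
    if "finite B" "B \<subseteq> carrier G" for B
    using that
  proof (induction B)
    case empty
    then show ?case using \<open>F a \<noteq> 0\<close> a zero by auto
  next
    case (insert e B)
    then have e: "e \<in> carrier G" by simp
    from insert obtain H where H: "\<exists>b\<in>carrier G. H b \<noteq> 0" "\<forall>\<pi>\<in>characters. char_sum H \<pi> = 0"
      "\<forall>b\<in>B. \<exists>\<omega>. \<omega> \<noteq> 0 \<and> (\<forall>d\<in>carrier G. H (d \<otimes> b) = \<omega> * H d)" by auto
    obtain b0 where b0: "b0 \<in> carrier G" "H b0 \<noteq> 0" using H(1) by blast
    obtain \<omega> c where \<omega>: "\<omega> \<noteq> 0"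
      "\<exists>d\<in>carrier G. (\<Sum>k < order G. c k * H (d \<otimes> e [^] k)) \<noteq> 0"
      "\<And>d. d \<in> carrier G \<Longrightarrow>
       (\<Sum>k < order G. c k * H (d \<otimes> e \<otimes> e [^] k)) = \<omega> * (\<Sum>k < order G. c k * H (d \<otimes> e [^] k))"
      by (rule exists_translation_eigenfunction[where F = H, OF fin e b0]) (rule that)
    \<comment> \<open>Translations multiply character sums by scalars, so \<open>K\<close> stays
      orthogonal to all characters. They also commute, so \<open>K\<close> keeps the eigenvalues of
      \<open>H\<close> for the elements of \<open>B\<close> and gains one for
      \<open>e\<close>.\<close>
    define K where "K = (\<lambda>d. \<Sum>k < order G. c k * H (d \<otimes> e [^] k))"
    have "char_sum K \<pi> = 0" if \<pi>: "\<pi> \<in> characters" for \<pi>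
    proof -
      have "char_sum K \<pi> = (\<Sum>k < order G. c k * (\<Sum>d\<in>carrier G. H (d \<otimes> e [^] k) * \<pi> d))"
        unfolding K_def sum_distrib_right by (subst sum.swap) (simp add: sum_distrib_left mult_ac)
      also have "\<dots> = (\<Sum>k < order G. c k * (\<pi> (inv (e [^] k)) * char_sum H \<pi>))"
      proof (intro sum.cong refl arg_cong2[where f="(*)"])
        fix k :: nat
        have "(\<Sum>d\<in>carrier G. H (d \<otimes> e [^] k) * \<pi> d) =
            (\<Sum>d\<in>carrier G. (\<lambda>d. H d * \<pi> (inv (e [^] k) \<otimes> d)) (e [^] k \<otimes> d))"
          using e by (intro sum.cong) (auto simp: inv_cancel_left m_comm[of _ "e [^] k"])
        also have "\<dots> = (\<Sum>d\<in>carrier G. H d * \<pi> (inv (e [^] k) \<otimes> d))"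
          using e by (intro sum_translate) simp
        finally show "(\<Sum>d\<in>carrier G. H (d \<otimes> e [^] k) * \<pi> d) = \<pi> (inv (e [^] k)) * char_sum H \<pi>"
          using e \<pi> by (simp add: character_mult sum_distrib_left mult_ac)
      qed
      finally show ?thesis using H(2) \<pi> by simp
    qed
    moreover have "\<exists>\<omega>. \<omega> \<noteq> 0 \<and> (\<forall>d\<in>carrier G. K (d \<otimes> b) = \<omega> * K d)" if b: "b \<in> B" for b
    proof -
      obtain \<theta> where \<theta>: "\<theta> \<noteq> 0" "\<And>d. d \<in> carrier G \<Longrightarrow> H (d \<otimes> b) = \<theta> * H d" using H(3) b by blast
      have bc: "b \<in> carrier G" using b insert.prems by auto
      have "K (d \<otimes> b) = \<theta> * K d" if d: "d \<in> carrier G" for d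
      proof -
        have "H (d \<otimes> b \<otimes> e [^] k) = \<theta> * H (d \<otimes> e [^] k)" for k :: nat
          using \<theta>(2)[of "d \<otimes> e [^] k"] d bc e by (simp add: m_ac)
        then show ?thesis by (simp add: K_def sum_distrib_left mult_ac)
      qed
      then show ?thesis using \<theta>(1) by blast
    qed
    ultimately show ?case using \<omega> by (intro exI[of _ K]) (auto simp: K_def)
  qed
  from this[OF fin] obtain H b where H: "b \<in> carrier G" "H b \<noteq> 0"
    "\<forall>\<pi>\<in>characters. char_sum H \<pi> = 0"
    "\<forall>b\<in>carrier G. \<exists>\<omega>. \<omega> \<noteq> 0 \<and> (\<forall>d\<in>carrier G. H (d \<otimes> b) = \<omega> * H d)" by auto
  \<comment> \<open>The eigenvalues form the desired character: \<open>H\<close> is determined by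
    its value at \<open>\<one>\<close>, and translating by a product in two ways gives
    multiplicativity.\<close>
  obtain \<chi> where \<chi>: "\<And>b. b \<in> carrier G \<Longrightarrow> \<chi> b \<noteq> 0"
    "\<And>b d. b \<in> carrier G \<Longrightarrow> d \<in> carrier G \<Longrightarrow> H (d \<otimes> b) = \<chi> b * H d"
    using H(4) by metis
  have Hb: "H d = \<chi> d * H \<one>" if "d \<in> carrier G" for d
    using \<chi>(2)[of d \<one>] that by simp
  have H1: "H \<one> \<noteq> 0" using H(2) Hb[OF H(1)] by auto
  have ch: "\<chi> \<in> characters"
  proof (rule charactersI)
    fix a b assume ab: "a \<in> carrier G" "b \<in> carrier G"
    then have "\<chi> (a \<otimes> b) * H \<one> = \<chi> a * \<chi> b * H \<one>"
      using Hb[of "a \<otimes> b"] \<chi>(2)[of b a] Hb[of a] by (auto simp: mult.commute)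
    then show "\<chi> (a \<otimes> b) = \<chi> a * \<chi> b" using H1 by simp
  qed (use \<chi> in auto)
  have "H a * \<chi> (inv a) = H \<one>" if "a \<in> carrier G" for a
    using \<chi>(1) that by (simp add: Hb[OF that] character_inv[OF ch])
  \<comment> \<open>Every summand equals \<open>H \<one>\<close>, so the sum is the group order
    times a nonzero number.\<close>
  then have "char_sum H (\<lambda>a. \<chi> (inv a)) = of_nat (order G) * H \<one>"
    by (simp add: order_def)
  moreover have "char_sum H (\<lambda>a. \<chi> (inv a)) = 0"
    using bspec[OF H(3) character_compose_inv[OF ch]] by simp
  ultimately show False using H1 fin order_gt_0_iff_finite by simp
qed

lemma character_sums_determine:
  fixes F H :: "'a \<Rightarrow> complex"
  assumes "finite (carrier G)"
    and "\<And>\<pi>. \<pi> \<in> characters \<Longrightarrow> char_sum F \<pi> = char_sum H \<pi>"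
    and "a \<in> carrier G"
  shows "F a = H a"
  using character_completeness[of "\<lambda>a. F a - H a" a] assms
  by (simp add: left_diff_distrib sum_subtractf)

end

section \<open>Integrality of character sums\<close>

context comm_group
begin

text \<open>This is the ring generated over the integers by the values of \<open>\<pi>\<close>. It
  can be written as a span because these values are closed under multiplication, and the finite
  spanning set makes multiplication by an element an integer matrix.\<close>

definition char_ring :: "('a \<Rightarrow> complex) \<Rightarrow> complex set" where
  "char_ring \<pi> = {char_sum (\<lambda>a. of_int (R a)) \<pi> |R. True}"

lemma char_ringI: "char_sum (\<lambda>a. of_int (R a)) \<pi> \<in> char_ring \<pi>"
  by (auto simp: char_ring_def)

lemma char_ring_add:
  assumes "x \<in> char_ring \<pi>" "y \<in> char_ring \<pi>"
  shows "x + y \<in> char_ring \<pi>"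
proof -
  obtain R Q where "x = char_sum (\<lambda>a. of_int (R a)) \<pi>" "y = char_sum (\<lambda>a. of_int (Q a)) \<pi>"
    using assms by (auto simp: char_ring_def)
  then have "x + y = char_sum (\<lambda>a. of_int (R a + Q a)) \<pi>"
    by (simp add: sum.distrib algebra_simps)
  then show ?thesis by (simp only: char_ringI)
qed

lemma char_ring_character:
  assumes fin: "finite (carrier G)" and a: "a \<in> carrier G"
  shows "\<pi> a \<in> char_ring \<pi>"
proof -
  have "char_sum (\<lambda>b. of_int (if b = a then 1 else 0)) \<pi> = (\<Sum>b\<in>carrier G. if b = a then \<pi> b else 0)"
    by (intro sum.cong) auto
  also have "\<dots> = \<pi> a" using fin a by simp
  finally show ?thesis using char_ringI[of "\<lambda>b. if b = a then 1 else 0" \<pi>] by (simp only:)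
qed

lemma char_ring_mult:
  assumes \<pi>: "\<pi> \<in> characters" and "x \<in> char_ring \<pi>" "y \<in> char_ring \<pi>"
  shows "x * y \<in> char_ring \<pi>"
proof -
  obtain R Q where x: "x = char_sum (\<lambda>a. of_int (R a)) \<pi>" and y: "y = char_sum (\<lambda>a. of_int (Q a)) \<pi>"
    using assms by (auto simp: char_ring_def)
  have "of_int (R a) * \<pi> a * y = (\<Sum>c\<in>carrier G. of_int (R a * Q (inv a \<otimes> c)) * \<pi> c)"
    if a: "a \<in> carrier G" for a
  proof -
    have "of_int (R a) * \<pi> a * y =
        (\<Sum>b\<in>carrier G. (\<lambda>c. of_int (R a * Q (inv a \<otimes> c)) * \<pi> c) (a \<otimes> b))"
      unfolding y sum_distrib_left using a \<pi>
      by (intro sum.cong) (auto simp: inv_cancel_left character_mult)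
    then show ?thesis using sum_translate[OF a] by simp
  qed
  then have "x * y = (\<Sum>a\<in>carrier G. \<Sum>c\<in>carrier G. of_int (R a * Q (inv a \<otimes> c)) * \<pi> c)"
    by (simp add: x sum_distrib_right)
  also have "\<dots> = char_sum (\<lambda>c. of_int (\<Sum>a\<in>carrier G. R a * Q (inv a \<otimes> c))) \<pi>"
    by (subst sum.swap) (simp add: sum_distrib_right)
  \<comment> \<open>The product has as coefficients the convolution of \<open>R\<close> and
    \<open>Q\<close>, as in the integral group ring.\<close>
  finally show ?thesis by (simp only: char_ringI)
qed

lemma char_ring_of_int:
  assumes fin: "finite (carrier G)" and \<pi>: "\<pi> \<in> characters"
  shows "of_int m \<in> char_ring \<pi>"
proof -
  have "char_sum (\<lambda>b. of_int (if b = \<one> then m else 0)) \<pi>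
      = (\<Sum>b\<in>carrier G. if b = \<one> then of_int m * \<pi> b else 0)"
    by (intro sum.cong) auto
  also have "\<dots> = of_int m" using fin \<pi> by (simp add: character_one)
  finally show ?thesis using char_ringI[of "\<lambda>b. if b = \<one> then m else 0" \<pi>] by (simp only:)
qed

text \<open>Multiplication by \<open>z\<close> acts on the vector of all values of
  \<open>\<pi>\<close> through the integer matrix with entries \<open>R (inv b \<otimes> c)\<close>.
  The vector is nonzero since \<open>\<pi> \<one> = 1\<close>, so \<open>z\<close> is an algebraic
  integer, and a rational one is an integer.\<close>

lemma char_ring_Rats_imp_Ints:
  assumes fin: "finite (carrier G)" and \<pi>: "\<pi> \<in> characters"
    and z: "z \<in> char_ring \<pi>" "z \<in> \<rat>"
  shows "z \<in> \<int>"
proof -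
  obtain R where R: "z = char_sum (\<lambda>a. of_int (R a)) \<pi>"
    using z by (auto simp: char_ring_def)
  have "algebraic_int z"
  proof (rule algebraic_int_eigenvalue[of "carrier G" \<one> \<pi> _ "\<lambda>b c. R (inv b \<otimes> c)"])
    fix b assume b: "b \<in> carrier G"
    have "z * \<pi> b = (\<Sum>a\<in>carrier G. (\<lambda>c. of_int (R (inv b \<otimes> c)) * \<pi> c) (b \<otimes> a))"
      unfolding R sum_distrib_right using b \<pi>
      by (intro sum.cong) (auto simp: inv_cancel_left character_mult)
    then show "z * \<pi> b = (\<Sum>c\<in>carrier G. of_int (R (inv b \<otimes> c)) * \<pi> c)"
      using sum_translate[OF b] by simp
  qed (use fin \<pi> in \<open>auto simp: character_one\<close>)
  then show ?thesis using z(2) by (rule rational_algebraic_int_is_int)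
qed

text \<open>Expanding the \<open>p\<close>-th power of the character sum, and using Fermat both for
  this integer and for the weights \<open>L a\<close>, writes the difference of the two sides as
  \<open>p\<close> times some \<open>v\<close> in \<open>char_ring \<pi>\<close>. By
  \<open>int\<close> this \<open>v\<close> is rational, hence an integer, and the lower bound on
  \<open>p\<close> leaves only \<open>v = 0\<close>.\<close>

lemma char_sum_frobenius:
  fixes L :: "'a \<Rightarrow> nat" and p :: nat
  assumes fin: "finite (carrier G)"
    and int: "\<And>\<pi>. \<pi> \<in> characters \<Longrightarrow> char_sum (\<lambda>a. of_nat (L a)) \<pi> \<in> \<int>"
    and p: "Factorial_Ring.prime p" "2 * (\<Sum>a\<in>carrier G. L a) < p"
    and \<pi>: "\<pi> \<in> characters"
  shows "char_sum (\<lambda>a. of_nat (L a)) (\<lambda>a. \<pi> (a [^] p)) = char_sum (\<lambda>a. of_nat (L a)) \<pi>"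
proof -
  let ?T = "char_sum (\<lambda>a. of_nat (L a))" and ?R = "char_ring \<pi>" and ?\<pi>p = "\<lambda>a. \<pi> (a [^] p)"
  have \<pi>p: "?\<pi>p \<in> characters" using \<pi> by (rule character_compose_pow)
  note ring = char_ring_of_int[OF fin \<pi>] char_ring_add[of _ \<pi>] char_ring_mult[OF \<pi>]
  have nat: "of_nat n \<in> ?R" for n using ring(1)[of "int n"] by simp
  have sum: "sum f I \<in> ?R" if "\<And>a. a \<in> I \<Longrightarrow> f a \<in> ?R" for f and I :: "'a set"
    using that ring(1)[of 0] by (induction I rule: infinite_finite_induct) (auto intro: ring(2))
  have "\<exists>w\<in>?R. ?T \<pi> ^ p = (\<Sum>a\<in>carrier G. (of_nat (L a) * \<pi> a) ^ p) + of_nat p * w"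
    by (intro prime_power_sum[OF p(1)] fin ring nat char_ring_character[OF fin])
  then obtain w where w: "w \<in> ?R"
    "?T \<pi> ^ p = (\<Sum>a\<in>carrier G. (of_nat (L a) * \<pi> a) ^ p) + of_nat p * w" by blast
  obtain l where l: "?T \<pi> = of_int l" using int[OF \<pi>] by (auto elim: Ints_cases)
  obtain q where q: "l ^ p = l + int p * q"
    using fermat_little_int[OF p(1), of l] by (auto simp: dvd_def algebra_simps)
  have "\<exists>r. int (L a) ^ p = int (L a) + int p * r" for a
    using fermat_little_int[OF p(1), of "int (L a)"] by (auto simp: dvd_def algebra_simps)
  then obtain r where r: "\<And>a. int (L a) ^ p = int (L a) + int p * r a" by metis
  have r': "of_nat (L a) ^ p = (of_nat (L a) + of_nat p * of_int (r a) :: complex)" for a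
    using arg_cong[OF r[of a], of "of_int :: int \<Rightarrow> complex"] by simp
  \<comment> \<open>Subtraction is written as multiplication by \<open>of_int (-1)\<close>, so that
    the closure of the ring under sums and products yields membership.\<close>
  define v where "v = of_int q + of_int (-1) * w + of_int (-1) * (\<Sum>a\<in>carrier G. of_int (r a) * \<pi> (a [^] p))"
  have "(\<Sum>a\<in>carrier G. of_int (r a) * \<pi> (a [^] p)) \<in> ?R"
    by (intro sum ring(1,3) char_ring_character[OF fin]) auto
  then have v: "v \<in> ?R" unfolding v_def by (intro ring(1,2,3) w)
  have "(\<Sum>a\<in>carrier G. (of_nat (L a) * \<pi> a) ^ p) =
      ?T ?\<pi>p + of_nat p * (\<Sum>a\<in>carrier G. of_int (r a) * \<pi> (a [^] p))"
    unfolding sum_distrib_left sum.distrib[symmetric] using \<pi>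
    by (intro sum.cong) (auto simp: power_mult_distrib r' character_pow algebra_simps)
  moreover have "?T \<pi> ^ p = of_int l + of_nat p * of_int q"
    using arg_cong[OF q, of "of_int :: int \<Rightarrow> complex"] by (simp add: l)
  moreover have rearrange: "s - l' = p' * (q' + of_int (-1) * w' + of_int (-1) * t)"
    if "l' + p' * q' = s + p' * t + p' * w'" for s t l' p' q' w' :: complex
    using that by (simp add: algebra_simps)
  ultimately have eq: "?T ?\<pi>p - ?T \<pi> = of_nat p * v"
    using rearrange w(2) unfolding v_def l by simp
  have p0: "of_nat p \<noteq> (0::complex)" using p(1) by (simp add: prime_gt_0_nat)
  have "v = (?T ?\<pi>p - ?T \<pi>) / of_nat p" using eq p0 by simp
  moreover have "?T ?\<pi>p - ?T \<pi> \<in> \<rat>" 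
    by (intro Rats_diff subsetD[OF Ints_subset_Rats] int \<pi> \<pi>p)
  ultimately have "v \<in> \<rat>" by (simp only: Rats_divide Rats_of_nat)
  then have "v \<in> \<int>" by (rule char_ring_Rats_imp_Ints[OF fin \<pi> v])
  then obtain u where u: "v = of_int u" by (auto elim: Ints_cases)
  \<comment> \<open>Character values have modulus 1, so each of the two sums is bounded by the total
    weight; this is where the factor 2 in the bound on \<open>p\<close> comes from.\<close>
  have bound: "cmod (?T \<chi>) \<le> real (\<Sum>a\<in>carrier G. L a)" if "\<chi> \<in> characters" for \<chi>
  proof -
    have "cmod (?T \<chi>) \<le> (\<Sum>a\<in>carrier G. cmod (of_nat (L a) * \<chi> a))" by (rule norm_sum)
    also have "\<dots> = real (\<Sum>a\<in>carrier G. L a)"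
      using norm_character[OF fin that] by (simp add: norm_mult)
    finally show ?thesis .
  qed
  have "cmod (of_nat p * v) \<le> cmod (?T ?\<pi>p) + cmod (?T \<pi>)"
    unfolding eq[symmetric] by (rule norm_triangle_ineq4)
  also have "\<dots> \<le> real (2 * (\<Sum>a\<in>carrier G. L a))" using bound[OF \<pi>] bound[OF \<pi>p] by simp
  also have "\<dots> < real p" using p(2) by (simp only: of_nat_less_iff)
  finally have "real p * \<bar>real_of_int u\<bar> < real p" by (simp add: u norm_mult)
  then have "u = 0" using p(1) by (simp add: prime_gt_0_nat)
  then show ?thesis using eq u by simp
qed

text \<open>One prime factor is removed at a time: for \<open>k = p * m\<close> the Frobenius step
  is applied to the character \<open>\<lambda>b. \<pi> (b [^] m)\<close>, which is possible because
  integrality is assumed for all characters at once.\<close>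

lemma char_sum_power:
  fixes L :: "'a \<Rightarrow> nat" and k :: nat
  assumes fin: "finite (carrier G)"
    and int: "\<And>\<pi>. \<pi> \<in> characters \<Longrightarrow> char_sum (\<lambda>a. of_nat (L a)) \<pi> \<in> \<int>"
    and k: "k > 0" "\<And>p. Factorial_Ring.prime p \<Longrightarrow> p dvd k \<Longrightarrow> 2 * (\<Sum>a\<in>carrier G. L a) < p"
    and \<pi>: "\<pi> \<in> characters"
  shows "char_sum (\<lambda>a. of_nat (L a)) (\<lambda>a. \<pi> (a [^] k)) = char_sum (\<lambda>a. of_nat (L a)) \<pi>"
  using k
proof (induction k rule: less_induct)
  case (less k)
  show ?case
  proof (cases "k = 1")
    case True
    then show ?thesis by (intro sum.cong) auto
  next
    case False
    then obtain p where p: "Factorial_Ring.prime p" "p dvd k" using prime_factor_nat by blast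
    then obtain m where m: "k = p * m" by auto
    have m0: "m > 0" "m < k" using less.prems(1) prime_gt_1_nat[OF p(1)] by (auto simp: m)
    have "char_sum (\<lambda>a. of_nat (L a)) (\<lambda>a. \<pi> (a [^] k)) =
        char_sum (\<lambda>a. of_nat (L a)) (\<lambda>a. (\<lambda>b. \<pi> (b [^] m)) (a [^] p))"
      by (intro sum.cong) (auto simp: m nat_pow_pow)
    also have "\<dots> = char_sum (\<lambda>a. of_nat (L a)) (\<lambda>b. \<pi> (b [^] m))"
      using less.prems(2)[OF p] by (intro char_sum_frobenius[OF fin int] p character_compose_pow \<pi>)
    also have "\<dots> = char_sum (\<lambda>a. of_nat (L a)) \<pi>"
      using less.prems(2) m0 by (intro less.IH) (auto simp: m)
    finally show ?thesis .
  qed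
qed

section \<open>Generators of the same cyclic subgroup\<close>

lemma same_generate_imp_coprime_power:
  assumes fin: "finite (carrier G)" and a: "a \<in> carrier G" and b: "b \<in> carrier G"
    and eq: "generate G {a} = generate G {b}"
  obtains k :: nat where "b = a [^] k" "coprime k (ord a)"
proof -
  have "b \<in> generate G {a}" "a \<in> generate G {b}" using eq by (auto intro: generate.incl)
  then obtain k j :: nat where k: "b = a [^] k" and j: "a = b [^] j"
    using generate_pow_on_finite_carrier[OF fin a] generate_pow_on_finite_carrier[OF fin b] by auto
  \<comment> \<open>Going from \<open>a\<close> to \<open>b\<close> and back shows that
    \<open>k * j\<close> is 1 modulo \<open>ord a\<close>, so \<open>k\<close> is a unit
    there.\<close>
  have "a [^] int (k * j) = a [^] (1::int)"
    using j k a by (simp only: int_pow_int nat_pow_pow) (simp add: int_pow_1)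
  then have "int (ord a) dvd 1 - int (k * j)" using int_pow_eq[OF a] by blast
  then have "[int (k * j) = 1] (mod int (ord a))"
    by (metis cong_iff_dvd_diff cong_sym)
  then have "coprime (int (k * j)) (int (ord a))"
    using cong_imp_coprime cong_sym coprime_1_left by blast
  then have "coprime k (ord a)" by simp
  then show thesis using that k by blast
qed

text \<open>Replacing the exponent by \<open>k'\<close> with large prime factors makes the power map
  \<open>k'\<close> a permutation of the group under which all character sums of \<open>L\<close>
  are invariant. By completeness \<open>L\<close> itself is invariant under the inverse permutation,
  which takes \<open>b\<close> to \<open>a\<close>.\<close>

proposition integral_char_sums_imp_constant_on_generators:
  fixes L :: "'a \<Rightarrow> nat"
  assumes fin: "finite (carrier G)"
    and int: "\<And>\<pi>. \<pi> \<in> characters \<Longrightarrow> char_sum (\<lambda>a. of_nat (L a)) \<pi> \<in> \<int>"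
    and a: "a \<in> carrier G" and b: "b \<in> carrier G"
    and eq: "generate G {a} = generate G {b}"
  shows "L a = L b"
proof -
  obtain k where k: "b = a [^] k" "coprime k (ord a)"
    using same_generate_imp_coprime_power[OF fin a b eq] .
  \<comment> \<open>The first bound meets the hypothesis of \<open>char_sum_power\<close>; the
    second makes \<open>k'\<close> coprime to the group order, and not only to
    \<open>ord a\<close>.\<close>
  define N where "N = max (2 * (\<Sum>a\<in>carrier G. L a)) (order G)"
  have "ord a > 0" using ord_ge_1[OF fin a] by simp
  then obtain k' where k': "k' > 0" "[k' = k] (mod ord a)" "\<And>p. Factorial_Ring.prime p \<Longrightarrow> p dvd k' \<Longrightarrow> p > N"
    using exists_cong_large_prime_factors[OF k(2), of N] by blast
  have b': "b = a [^] k'"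
    using k'(2) a int_pow_eq[OF a, of "int k" "int k'"]
    by (simp add: k(1) int_pow_int cong_int_iff[symmetric] cong_iff_dvd_diff)
  have n0: "order G > 0" using fin order_gt_0_iff_finite by simp
  have "coprime k' (order G)"
  proof (rule ccontr)
    assume "\<not> coprime k' (order G)"
    then have "gcd k' (order G) \<noteq> 1" by (simp add: coprime_iff_gcd_eq_1)
    then obtain p where p: "Factorial_Ring.prime p" "p dvd k'" "p dvd order G"
      using prime_factor_nat[of "gcd k' (order G)"] by auto
    then have "p \<le> order G" using n0 by (intro dvd_imp_le)
    then show False using k'(3)[OF p(1,2)] by (simp add: N_def)
  qed
  then obtain u where u: "[k' * u = 1] (mod order G)" using cong_solve_coprime_nat by auto
  have inv: "d [^] (k' * u) = d" if d: "d \<in> carrier G" for d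
  proof -
    have "[int (k' * u) = int 1] (mod int (ord d))"
      using u ord_dvd_group_order[OF d] cong_dvd_modulus_nat cong_int_iff by blast
    then have "d [^] int (k' * u) = d [^] int 1"
      using int_pow_eq[OF d] by (metis cong_iff_dvd_diff cong_sym)
    then show ?thesis using d by (simp only: int_pow_int) simp
  qed
  have "of_nat (L (b [^] u)) = (of_nat (L b) :: complex)"
  proof (rule character_sums_determine[OF fin _ b])
    fix \<pi> assume \<pi>: "\<pi> \<in> characters"
    \<comment> \<open>Substituting \<open>d = a [^] k'\<close> moves the power from \<open>L\<close>
      to the character.\<close>
    have "char_sum (\<lambda>d. of_nat (L (d [^] u))) \<pi> = char_sum (\<lambda>a. of_nat (L a)) (\<lambda>a. \<pi> (a [^] k'))"
      by (rule sum.reindex_bij_witness[of _ "\<lambda>a. a [^] k'" "\<lambda>d. d [^] u"])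
        (auto simp: nat_pow_pow inv mult.commute[of u])
    also have "\<dots> = char_sum (\<lambda>a. of_nat (L a)) \<pi>"
      using k'(1,3) by (intro char_sum_power[OF fin int _ _ \<pi>]) (auto simp: N_def)
    finally show "char_sum (\<lambda>d. of_nat (L (d [^] u))) \<pi> = char_sum (\<lambda>a. of_nat (L a)) \<pi>" .
  qed
  then show ?thesis using inv[OF a] a by (simp add: b' nat_pow_pow)
qed

section \<open>Character sums over subgroups and atoms\<close>

lemma character_subgroup_sum:
  assumes "subgroup H G" "\<pi> \<in> characters"
  shows "(\<Sum>a\<in>H. \<pi> a) \<in> \<int>"
proof (cases "\<forall>h\<in>H. \<pi> h = 1")
  case True
  then show ?thesis by simp
next
  case False
  then obtain h where h: "h \<in> H" "\<pi> h \<noteq> 1" by blast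
  interpret H: subgroup H G by fact
  \<comment> \<open>Translation by \<open>h\<close> permutes \<open>H\<close>, so the sum is fixed
    under multiplication by \<open>\<pi> h \<noteq> 1\<close> and must be 0.\<close>
  have "\<pi> h * (\<Sum>a\<in>H. \<pi> a) = (\<Sum>a\<in>H. \<pi> (h \<otimes> a))"
    unfolding sum_distrib_left using h assms(2) by (intro sum.cong) (auto simp: character_mult)
  also have "\<dots> = (\<Sum>a\<in>H. \<pi> a)"
    using h by (intro sum.reindex_bij_witness[of _ "\<lambda>b. inv h \<otimes> b" "\<lambda>b. h \<otimes> b"])
      (auto simp: m_assoc[symmetric])
  finally show ?thesis using h(2) by simp
qed

lemma atom_eq_iff:
  assumes "a \<in> carrier G"
  shows "atom G a = atom G b \<longleftrightarrow> generate G {a} = generate G {b}"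
proof
  assume "atom G a = atom G b"
  moreover have "a \<in> atom G a" using assms by (simp add: atom_def)
  ultimately have "a \<in> atom G b" by simp
  then show "generate G {a} = generate G {b}" by (simp add: atom_def)
qed (simp add: atom_def)

text \<open>The induction is on the order of the cyclic group generated by \<open>g\<close>. That
  group is a disjoint union of atoms; every atom other than that of \<open>g\<close> consists of
  generators of a proper subgroup, and the sum over the whole group is an integer.\<close>

lemma character_atom_sum:
  assumes fin: "finite (carrier G)" and \<pi>: "\<pi> \<in> characters" and g: "g \<in> carrier G"
  shows "(\<Sum>a\<in>atom G g. \<pi> a) \<in> \<int>"
  using g
proof (induction "card (generate G {g})" arbitrary: g rule: less_induct)
  case less
  let ?H = "generate G {g}"
  have sub: "subgroup ?H G" using less.prems by (intro generate_is_subgroup) simp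
  then have HG: "?H \<subseteq> carrier G" by (rule subgroup.subset)
  then have finH: "finite ?H" using fin finite_subset by blast
  have gH: "g \<in> ?H" by (auto intro: generate.incl)
  have in_H: "generate G {h} \<subseteq> ?H" if "h \<in> ?H" for h
    using that by (intro generate_subgroup_incl[OF _ sub]) simp
  have part: "{x \<in> ?H. atom G x = atom G h} = atom G h" if h: "h \<in> ?H" for h
  proof (intro equalityI subsetI)
    fix x assume "x \<in> {x \<in> ?H. atom G x = atom G h}"
    then show "x \<in> atom G h" using HG by (auto simp: atom_def)
  next
    fix x assume x: "x \<in> atom G h"
    then have "x \<in> generate G {x}" "generate G {x} = generate G {h}" "x \<in> carrier G"
      by (auto simp: atom_def intro: generate.incl)
    then show "x \<in> {x \<in> ?H. atom G x = atom G h}" using in_H[OF h] by (auto simp: atom_eq_iff)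
  qed
  have "(\<Sum>a\<in>?H. \<pi> a) = (\<Sum>\<alpha>\<in>atom G ` ?H. \<Sum>a\<in>{x \<in> ?H. atom G x = \<alpha>}. \<pi> a)"
    using finH by (intro sum.group[symmetric]) auto
  also have "\<dots> = (\<Sum>\<alpha>\<in>atom G ` ?H. \<Sum>a\<in>\<alpha>. \<pi> a)"
  proof (rule sum.cong[OF refl])
    fix \<alpha> assume "\<alpha> \<in> atom G ` ?H"
    then obtain h where h: "h \<in> ?H" "\<alpha> = atom G h" by blast
    show "(\<Sum>a\<in>{x \<in> ?H. atom G x = \<alpha>}. \<pi> a) = (\<Sum>a\<in>\<alpha>. \<pi> a)"
      unfolding h(2) part[OF h(1)] ..
  qed
  also have "\<dots> = (\<Sum>a\<in>atom G g. \<pi> a) + (\<Sum>\<alpha>\<in>atom G ` ?H - {atom G g}. \<Sum>a\<in>\<alpha>. \<pi> a)"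
    using finH gH by (intro sum.remove) auto
  finally have "(\<Sum>a\<in>atom G g. \<pi> a) =
      (\<Sum>a\<in>?H. \<pi> a) - (\<Sum>\<alpha>\<in>atom G ` ?H - {atom G g}. \<Sum>a\<in>\<alpha>. \<pi> a)" by simp
  moreover have "(\<Sum>\<alpha>\<in>atom G ` ?H - {atom G g}. \<Sum>a\<in>\<alpha>. \<pi> a) \<in> \<int>"
  proof (rule Ints_sum)
    fix \<alpha> assume "\<alpha> \<in> atom G ` ?H - {atom G g}"
    then obtain h where h: "h \<in> ?H" "\<alpha> = atom G h" "atom G h \<noteq> atom G g" by auto
    have hG: "h \<in> carrier G" using h HG by auto
    have "generate G {h} \<subset> ?H" using in_H[OF h(1)] h(3) atom_eq_iff[OF hG] by auto
    then have "card (generate G {h}) < card ?H" using finH by (rule psubset_card_mono[rotated])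
    then show "(\<Sum>a\<in>\<alpha>. \<pi> a) \<in> \<int>" unfolding h(2) using hG by (rule less.hyps)
  qed
  ultimately show ?case using character_subgroup_sum[OF sub \<pi>] by simp
qed

text \<open>The sum splits over the atoms; on each of them \<open>L\<close> is constant and factors
  out of an integral sum.\<close>

lemma char_sum_constant_on_generators:
  fixes L :: "'a \<Rightarrow> nat"
  assumes fin: "finite (carrier G)" and \<pi>: "\<pi> \<in> characters"
    and const: "\<And>a b. a \<in> carrier G \<Longrightarrow> b \<in> carrier G \<Longrightarrow>
      generate G {a} = generate G {b} \<Longrightarrow> L a = L b"
  shows "char_sum (\<lambda>a. of_nat (L a)) \<pi> \<in> \<int>"
proof -
  have part: "{x \<in> carrier G. atom G x = atom G h} = atom G h" for h
  proof (intro equalityI subsetI)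
    fix x assume "x \<in> {x \<in> carrier G. atom G x = atom G h}"
    then show "x \<in> atom G h" using atom_eq_iff[of x h] by (simp add: atom_def)
  next
    fix x assume "x \<in> atom G h"
    then show "x \<in> {x \<in> carrier G. atom G x = atom G h}"
      using atom_eq_iff[of x h] by (simp add: atom_def)
  qed
  have "char_sum (\<lambda>a. of_nat (L a)) \<pi> =
      (\<Sum>\<alpha>\<in>atom G ` carrier G. \<Sum>a\<in>{x \<in> carrier G. atom G x = \<alpha>}. of_nat (L a) * \<pi> a)"
    using fin by (intro sum.group[symmetric]) auto
  also have "\<dots> \<in> \<int>"
  proof (rule Ints_sum)
    fix \<alpha> assume "\<alpha> \<in> atom G ` carrier G"
    then obtain h where h: "h \<in> carrier G" "\<alpha> = atom G h" by auto
    have Lh: "L a = L h" if "a \<in> atom G h" for a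
      using that const[of a h] h(1) by (simp add: atom_def)
    have "(\<Sum>a\<in>{x \<in> carrier G. atom G x = \<alpha>}. of_nat (L a) * \<pi> a) =
        of_nat (L h) * (\<Sum>a\<in>atom G h. \<pi> a)"
      unfolding h(2) part sum_distrib_left by (rule sum.cong) (simp_all add: Lh)
    then show "(\<Sum>a\<in>{x \<in> carrier G. atom G x = \<alpha>}. of_nat (L a) * \<pi> a) \<in> \<int>"
      using character_atom_sum[OF fin \<pi> h(1)] by (auto intro: Ints_mult)
  qed
  finally show ?thesis .
qed

text \<open>This translates membership in C(A) into the form used with characters. Two generators of
  one cyclic group lie in the same atoms, so each summand treats them alike. Conversely all atoms
  are taken, each weighted by \<open>L\<close>.\<close>

lemma atomic_msets_iff:
  fixes L :: "'a \<Rightarrow> nat"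
  assumes fin: "finite (carrier G)"
  shows "mk_mset (carrier G) L \<in> atomic_msets G \<longleftrightarrow>
    (\<forall>a\<in>carrier G. \<forall>b\<in>carrier G. generate G {a} = generate G {b} \<longrightarrow> L a = L b)"
    (is "?l \<longleftrightarrow> ?r")
proof
  assume ?l
  then obtain T f where T: "T \<subseteq> atoms G" "\<forall>\<alpha>\<in>T. \<exists>c. \<forall>a\<in>\<alpha>. f \<alpha> a = c"
    and eq: "mk_mset (carrier G) L = mset_sum (\<lambda>\<alpha>. mk_mset \<alpha> (f \<alpha>)) T"
    by (auto simp: atomic_msets_def)
  have L: "L a = (\<Sum>\<alpha>\<in>T. if a \<in> \<alpha> then f \<alpha> a else 0)" if "a \<in> carrier G" for a
  proof -
    have "carrier G = \<Union>T" using eq by (auto simp: mk_mset_def mset_sum_def)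
    moreover have "restrict L (carrier G) a =
        snd (mset_sum (\<lambda>\<alpha>. mk_mset \<alpha> (f \<alpha>)) T) a"
      using eq by (metis mk_mset_def snd_conv)
    ultimately show ?thesis using that
      by (simp add: mset_sum_def mk_mset_def mset_mult_def cong: sum.cong if_cong)
  qed
  show ?r
  proof (intro ballI impI)
    fix a b assume ab: "a \<in> carrier G" "b \<in> carrier G" "generate G {a} = generate G {b}"
    have "(if a \<in> \<alpha> then f \<alpha> a else 0) = (if b \<in> \<alpha> then f \<alpha> b else 0)" if "\<alpha> \<in> T" for \<alpha>
    proof -
      have "a \<in> \<alpha> \<longleftrightarrow> b \<in> \<alpha>" using that T(1) ab by (auto simp: atoms_def atom_def)
      moreover have "f \<alpha> a = f \<alpha> b" if "a \<in> \<alpha>" "b \<in> \<alpha>" using that \<open>\<alpha> \<in> T\<close> T(2) by metis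
      ultimately show ?thesis by simp
    qed
    then show "L a = L b" unfolding L[OF ab(1)] L[OF ab(2)] by (rule sum.cong[OF refl])
  qed
next
  assume r: ?r
  have fa: "finite (atoms G)" using fin by (simp add: atoms_def)
  have U: "\<Union>(atoms G) = carrier G" by (auto simp: atoms_def atom_def)
  \<comment> \<open>Atoms are equivalence classes, so only the summand of \<open>atom G a\<close>
    survives.\<close>
  have "(\<Sum>\<alpha>\<in>atoms G. if a \<in> \<alpha> then L a else 0) = L a" if a: "a \<in> carrier G" for a
  proof -
    have "a \<in> \<alpha> \<longleftrightarrow> \<alpha> = atom G a" if "\<alpha> \<in> atoms G" for \<alpha>
      using that a by (auto simp: atoms_def atom_def)
    then have "(\<Sum>\<alpha>\<in>atoms G. if a \<in> \<alpha> then L a else 0) = (\<Sum>\<alpha>\<in>atoms G. if \<alpha> = atom G a then L a else 0)"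
      by (intro sum.cong) auto
    also have "\<dots> = L a" using fa a by (simp add: atoms_def)
    finally show ?thesis .
  qed
  then have 1: "mk_mset (carrier G) L = mset_sum (\<lambda>\<alpha>. mk_mset \<alpha> L) (atoms G)"
    using U by (auto simp: mset_sum_def mk_mset_def mset_mult_def restrict_def fun_eq_iff cong: if_cong)
  have 2: "\<exists>c. \<forall>a\<in>\<alpha>. L a = c" if \<alpha>: "\<alpha> \<in> atoms G" for \<alpha>
  proof -
    obtain h where "h \<in> carrier G" "\<alpha> = atom G h" using \<alpha> by (auto simp: atoms_def)
    then have "L a = L h" if "a \<in> \<alpha>" for a
      using that r[rule_format, of a h] by (simp add: atom_def)
    then show ?thesis by blast
  qed
  show ?l
    unfolding atomic_msets_def
    by (intro CollectI exI[of _ "atoms G"] exI[of _ "\<lambda>_. L"] conjI ballI 1 2 subset_refl)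
qed

end

section \<open>The spectrum of the distance matrix\<close>

context comm_group
begin

section \<open>Character sums of translates and convolutions\<close>

lemma char_sum_translate:
  assumes \<pi>: "\<pi> \<in> characters" and a: "a \<in> carrier G"
  shows "(\<Sum>b\<in>carrier G. h (a \<otimes> b) * \<pi> b) = \<pi> (inv a) * char_sum h \<pi>"
proof -
  have "(\<Sum>b\<in>carrier G. h (a \<otimes> b) * \<pi> b) =
      (\<Sum>b\<in>carrier G. (\<lambda>c. h c * \<pi> (inv a \<otimes> c)) (a \<otimes> b))"
    using a by (intro sum.cong) (auto simp: inv_cancel_left)
  also have "\<dots> = (\<Sum>c\<in>carrier G. h c * \<pi> (inv a \<otimes> c))" by (rule sum_translate[OF a])
  also have "\<dots> = \<pi> (inv a) * char_sum h \<pi>"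
    unfolding sum_distrib_left using a \<pi> by (intro sum.cong) (auto simp: character_mult)
  finally show ?thesis .
qed

text \<open>The kernel depends on \<open>a \<otimes> b\<close> and not on a quotient, so this is a
  convolution with \<open>F\<close> composed with inversion. Hence \<open>F\<close> is paired with
  the inverse character.\<close>

lemma char_sum_convolution:
  assumes \<pi>: "\<pi> \<in> characters"
  shows "char_sum (\<lambda>a. \<Sum>b\<in>carrier G. h (a \<otimes> b) * F b) \<pi> =
    char_sum F (\<lambda>b. \<pi> (inv b)) * char_sum h \<pi>"
proof -
  have "char_sum (\<lambda>a. \<Sum>b\<in>carrier G. h (a \<otimes> b) * F b) \<pi> =
      (\<Sum>b\<in>carrier G. F b * (\<Sum>a\<in>carrier G. h (b \<otimes> a) * \<pi> a))"
    unfolding sum_distrib_right sum_distrib_left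
    by (subst sum.swap) (intro sum.cong refl, simp add: m_comm mult_ac)
  also have "\<dots> = (\<Sum>b\<in>carrier G. F b * (\<pi> (inv b) * char_sum h \<pi>))"
    by (intro sum.cong refl) (simp only: char_sum_translate[OF \<pi>])
  also have "\<dots> = char_sum F (\<lambda>b. \<pi> (inv b)) * char_sum h \<pi>"
    by (simp only: sum_distrib_right mult.assoc)
  finally show ?thesis .
qed

text \<open>Inverting the summation variable reduces this to \<open>char_sum_convolution\<close> for
  the inverse character.\<close>

lemma char_sum_inv_convolution:
  assumes \<pi>: "\<pi> \<in> characters"
  shows "char_sum (\<lambda>a. \<Sum>b\<in>carrier G. h (inv a \<otimes> b) * F b) \<pi> =
    char_sum F \<pi> * char_sum h (\<lambda>b. \<pi> (inv b))"
proof -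
  have "char_sum (\<lambda>a. \<Sum>b\<in>carrier G. h (inv a \<otimes> b) * F b) \<pi> =
      char_sum (\<lambda>a. \<Sum>b\<in>carrier G. h (inv (inv a) \<otimes> b) * F b) (\<lambda>a. \<pi> (inv a))"
    by (rule sum_inv[symmetric])
  also have "\<dots> = char_sum (\<lambda>a. \<Sum>b\<in>carrier G. h (a \<otimes> b) * F b) (\<lambda>a. \<pi> (inv a))"
    by (intro sum.cong refl) simp
  also have "\<dots> = char_sum F (\<lambda>b. \<pi> (inv (inv b))) * char_sum h (\<lambda>b. \<pi> (inv b))"
    by (rule char_sum_convolution[OF character_compose_inv[OF \<pi>]])
  also have "char_sum F (\<lambda>b. \<pi> (inv (inv b))) = char_sum F \<pi>"
    by (intro sum.cong refl) simp
  finally show ?thesis .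
qed

text \<open>With \<open>l\<close> and \<open>m\<close> the character sums of \<open>L\<close> and
  \<open>M\<close>, the kernel acts on the span of (\<open>\<pi>\<close>, 0) and (0, inverse of
  \<open>\<pi>\<close>) by the Hermitian matrix with rows (l, cnj m) and (m, l), whose eigenvalues
  are l plus or minus |m|. For the converse an eigenfunction is paired with all characters, which
  gives the same two-dimensional system.\<close>

proposition is_eigenvalue_dicyclic_kernel:
  fixes L M :: "'a \<Rightarrow> nat" and K :: "'a \<times> bool \<Rightarrow> 'a \<times> bool \<Rightarrow> complex"
  assumes fin: "finite (carrier G)"
    and sym: "\<And>a. a \<in> carrier G \<Longrightarrow> L (inv a) = L a"
    and K: "\<And>a b. \<lbrakk>a \<in> carrier G; b \<in> carrier G\<rbrakk> \<Longrightarrow> K (a, False) (b, False) = of_nat (L (inv a \<otimes> b))"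
      "\<And>a b. \<lbrakk>a \<in> carrier G; b \<in> carrier G\<rbrakk> \<Longrightarrow> K (a, False) (b, True) = of_nat (M (a \<otimes> b))"
      "\<And>a b. \<lbrakk>a \<in> carrier G; b \<in> carrier G\<rbrakk> \<Longrightarrow> K (a, True) (b, False) = of_nat (M (a \<otimes> b))"
      "\<And>a b. \<lbrakk>a \<in> carrier G; b \<in> carrier G\<rbrakk> \<Longrightarrow> K (a, True) (b, True) = of_nat (L (inv a \<otimes> b))"
  shows "is_eigenvalue (carrier G \<times> UNIV) K \<mu> \<longleftrightarrow>
    (\<exists>\<pi>\<in>characters. \<exists>s\<in>{1, -1}. \<mu> = char_sum (\<lambda>a. of_nat (L a)) \<pi> +
       s * of_real (cmod (char_sum (\<lambda>a. of_nat (M a)) \<pi>)))"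
    (is "?l \<longleftrightarrow> ?r")
proof -
  let ?L = "char_sum (\<lambda>a. of_nat (L a))" and ?M = "char_sum (\<lambda>a. of_nat (M a))"
  \<comment> \<open>The symmetry of \<open>L\<close> makes the two diagonal entries equal; as
    \<open>M\<close> is real, passing to the inverse character conjugates the off-diagonal
    entry.\<close>
  have L_inv: "?L (\<lambda>a. \<pi> (inv a)) = ?L \<pi>" for \<pi>
    unfolding sum_inv[of "\<lambda>a. of_nat (L a) * \<pi> a", symmetric] by (intro sum.cong) (auto simp: sym)
  have M_inv: "?M (\<lambda>a. \<pi> (inv a)) = cnj (?M \<pi>)" if "\<pi> \<in> characters" for \<pi>
    using character_inv_cnj[OF fin that] by simp
  have rows:
    "(\<Sum>v\<in>carrier G \<times> UNIV. K (a, False) v * f v) =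
      (\<Sum>b\<in>carrier G. of_nat (L (inv a \<otimes> b)) * f (b, False)) +
      (\<Sum>b\<in>carrier G. of_nat (M (a \<otimes> b)) * f (b, True))"
    "(\<Sum>v\<in>carrier G \<times> UNIV. K (a, True) v * f v) =
      (\<Sum>b\<in>carrier G. of_nat (M (a \<otimes> b)) * f (b, False)) +
      (\<Sum>b\<in>carrier G. of_nat (L (inv a \<otimes> b)) * f (b, True))"
    if "a \<in> carrier G" for a f
    using that by (simp_all add: sum_Times_bool[OF fin] K)
  show ?thesis
  proof
    assume ?l
    then obtain f v where v: "v \<in> carrier G \<times> UNIV" "f v \<noteq> 0"
      and ev: "\<And>u. u \<in> carrier G \<times> UNIV \<Longrightarrow> (\<Sum>v\<in>carrier G \<times> UNIV. K u v * f v) = \<mu> * f u"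
      unfolding is_eigenvalue_def by blast
    define F0 where "F0 = (\<lambda>a. f (a, False))"
    define F1 where "F1 = (\<lambda>a. f (a, True))"
    have row0: "\<mu> * F0 a = (\<Sum>b\<in>carrier G. of_nat (L (inv a \<otimes> b)) * F0 b) +
        (\<Sum>b\<in>carrier G. of_nat (M (a \<otimes> b)) * F1 b)" if "a \<in> carrier G" for a
      using ev[of "(a, False)"] that by (simp add: rows F0_def F1_def)
    have row1: "\<mu> * F1 a = (\<Sum>b\<in>carrier G. of_nat (M (a \<otimes> b)) * F0 b) +
        (\<Sum>b\<in>carrier G. of_nat (L (inv a \<otimes> b)) * F1 b)" if "a \<in> carrier G" for a
      using ev[of "(a, True)"] that by (simp add: rows F0_def F1_def)
    have eq0: "\<mu> * char_sum F0 \<pi> = ?L \<pi> * char_sum F0 \<pi> + ?M \<pi> * char_sum F1 (\<lambda>a. \<pi> (inv a))"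
      if \<pi>: "\<pi> \<in> characters" for \<pi>
    proof -
      have "\<mu> * char_sum F0 \<pi> = char_sum (\<lambda>a. \<Sum>b\<in>carrier G. of_nat (L (inv a \<otimes> b)) * F0 b) \<pi> +
          char_sum (\<lambda>a. \<Sum>b\<in>carrier G. of_nat (M (a \<otimes> b)) * F1 b) \<pi>"
        unfolding sum.distrib[symmetric] sum_distrib_left
        by (intro sum.cong refl) (simp only: row0 mult.assoc[symmetric] distrib_right)
      then show ?thesis
        unfolding char_sum_convolution[OF \<pi>, of "\<lambda>a. of_nat (M a)"]
          char_sum_inv_convolution[OF \<pi>, of "\<lambda>a. of_nat (L a)"] L_inv
        by (simp only: mult.commute)
    qed
    have eq1: "\<mu> * char_sum F1 (\<lambda>a. \<pi> (inv a)) =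
        ?L \<pi> * char_sum F1 (\<lambda>a. \<pi> (inv a)) + cnj (?M \<pi>) * char_sum F0 \<pi>"
      if \<pi>: "\<pi> \<in> characters" for \<pi>
    proof -
      let ?\<pi>' = "\<lambda>a. \<pi> (inv a)"
      note \<pi>' = character_compose_inv[OF \<pi>]
      have inv2: "char_sum H (\<lambda>a. \<pi> (inv (inv a))) = char_sum H \<pi>" for H
        by (intro sum.cong refl) simp
      have "\<mu> * char_sum F1 ?\<pi>' = char_sum (\<lambda>a. \<Sum>b\<in>carrier G. of_nat (M (a \<otimes> b)) * F0 b) ?\<pi>' +
          char_sum (\<lambda>a. \<Sum>b\<in>carrier G. of_nat (L (inv a \<otimes> b)) * F1 b) ?\<pi>'"
        unfolding sum.distrib[symmetric] sum_distrib_left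
        by (intro sum.cong refl) (simp only: row1 mult.assoc[symmetric] distrib_right)
      then show ?thesis
        unfolding char_sum_convolution[OF \<pi>', of "\<lambda>a. of_nat (M a)"]
          char_sum_inv_convolution[OF \<pi>', of "\<lambda>a. of_nat (L a)"] L_inv inv2 M_inv[OF \<pi>]
        by (simp only: mult.commute add.commute)
    qed
    define P where
      "P = (\<lambda>\<pi>. char_sum F0 \<pi> \<noteq> 0 \<or> char_sum F1 (\<lambda>a. \<pi> (inv a)) \<noteq> 0)"
    \<comment> \<open>If both components had only vanishing character sums, completeness would make
      the eigenfunction zero.\<close>
    have "\<exists>\<pi>\<in>characters. P \<pi>"
    proof (rule ccontr)
      assume "\<not> ?thesis"
      then have neg: "\<not> P \<pi>" if "\<pi> \<in> characters" for \<pi> using that by blast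
      obtain a q where aq: "v = (a, q)" "a \<in> carrier G" using v(1) by auto
      have "F0 a = 0"
        by (rule character_completeness[where F = F0, OF fin _ aq(2)]) (use neg in \<open>simp add: P_def\<close>)
      moreover have "F1 a = 0"
      proof (rule character_completeness[where F = F1, OF fin _ aq(2)])
        fix \<pi> assume \<pi>: "\<pi> \<in> characters"
        have "char_sum F1 (\<lambda>a. \<pi> (inv (inv a))) = 0"
          using neg[OF character_compose_inv[OF \<pi>]] by (simp only: P_def de_Morgan_disj not_not)
        moreover have "char_sum F1 (\<lambda>a. \<pi> (inv (inv a))) = char_sum F1 \<pi>"
          by (intro sum.cong refl) simp
        ultimately show "char_sum F1 \<pi> = 0" by simp
      qed
      ultimately show False using v(2) aq by (cases q) (auto simp: F0_def F1_def)
    qed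
    then obtain \<pi> where \<pi>: "\<pi> \<in> characters" and nz: "P \<pi>" by blast
    define x y l m where "x = char_sum F0 \<pi>" and "y = char_sum F1 (\<lambda>a. \<pi> (inv a))"
      and "l = ?L \<pi>" and "m = ?M \<pi>"
    have e: "(\<mu> - l) * x = m * y" "(\<mu> - l) * y = cnj m * x"
      using eq0[OF \<pi>] eq1[OF \<pi>] unfolding x_def[symmetric] y_def[symmetric] l_def[symmetric] m_def[symmetric]
      by (simp_all add: algebra_simps)
    \<comment> \<open>Inserting each equation into the other decouples the system; one of
      \<open>x\<close>, \<open>y\<close> is nonzero and can be cancelled.\<close>
    have "(\<mu> - l)\<^sup>2 * x = m * ((\<mu> - l) * y)" "(\<mu> - l)\<^sup>2 * y = cnj m * ((\<mu> - l) * x)"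
      unfolding power2_eq_square mult.assoc e by (simp_all only: e mult.left_commute)
    then have "((\<mu> - l)\<^sup>2 - m * cnj m) * x = 0" "((\<mu> - l)\<^sup>2 - m * cnj m) * y = 0"
      unfolding e by (simp_all add: algebra_simps)
    then have "(\<mu> - l)\<^sup>2 = m * cnj m" using nz unfolding P_def x_def[symmetric] y_def[symmetric] by auto
    also have "\<dots> = (of_real (cmod m))\<^sup>2"
      using complex_norm_square[of m] by (simp only: of_real_power)
    finally have "\<mu> - l = of_real (cmod m) \<or> \<mu> - l = - of_real (cmod m)"
      by (simp only: power2_eq_iff)
    then have "\<exists>s\<in>{1, -1}. \<mu> = l + s * of_real (cmod m)"
      by (auto simp: algebra_simps)
    then show ?r using \<pi> unfolding l_def m_def by blast
  next
    assume ?r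
    then obtain \<pi> s where \<pi>: "\<pi> \<in> characters" and s: "s \<in> {1, -1}"
      and \<mu>: "\<mu> = ?L \<pi> + s * of_real (cmod (?M \<pi>))" by blast
    define m t where "m = ?M \<pi>" and "t = s * of_real (cmod m)"
    have tt: "t * t = m * cnj m"
      using s complex_norm_square[of m] by (auto simp: t_def power2_eq_square simp del: of_real_mult simp flip: of_real_mult)
    \<comment> \<open>This is an eigenvector of the off-diagonal part for \<open>t\<close>. The
      choice (\<open>t\<close>, \<open>m\<close>) works by \<open>tt\<close> but vanishes for
      \<open>m = 0\<close>; then \<open>t = 0\<close> too, and (1, 0) serves.\<close>
    obtain c d where cd: "c \<noteq> 0 \<or> d \<noteq> 0" "cnj m * d = t * c" "m * c = t * d"
    proof (cases "m = 0")
      case True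
      then show ?thesis using that[of 1 0] by (simp add: t_def)
    next
      case False
      then show ?thesis using that[of t m] tt by (simp add: mult.commute)
    qed
    define f where "f = (\<lambda>(a, q). if q then d * \<pi> (inv a) else c * \<pi> a)"
    have pull: "(\<Sum>b\<in>carrier G. h b * (e * g b)) = e * (\<Sum>b\<in>carrier G. h b * g b)"
      for h g :: "'a \<Rightarrow> complex" and e
      by (simp add: sum_distrib_left mult_ac)
    have "(\<Sum>v\<in>carrier G \<times> UNIV. K (a, q) v * f v) = \<mu> * f (a, q)" if a: "a \<in> carrier G" for a q
    proof (cases q)
      case False
      have "(\<Sum>b\<in>carrier G. of_nat (L (inv a \<otimes> b)) * \<pi> b) = \<pi> a * ?L \<pi>"
        using char_sum_translate[OF \<pi>, of "inv a" "\<lambda>a. of_nat (L a)"] a by simp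
      moreover have "(\<Sum>b\<in>carrier G. of_nat (M (a \<otimes> b)) * \<pi> (inv b)) = \<pi> a * cnj m"
        using char_sum_translate[OF character_compose_inv[OF \<pi>] a, of "\<lambda>a. of_nat (M a)"] a
        by (simp only: inv_inv M_inv[OF \<pi>] m_def)
      ultimately have "(\<Sum>v\<in>carrier G \<times> UNIV. K (a, False) v * f v) =
          c * (\<pi> a * ?L \<pi>) + d * (\<pi> a * cnj m)"
        unfolding rows[OF a] f_def by (simp only: prod.case if_False if_True pull)
      also have "\<dots> = \<pi> a * (?L \<pi> * c + cnj m * d)" by (simp only: distrib_left mult_ac)
      also have "\<dots> = \<mu> * (c * \<pi> a)"
        unfolding cd(2) \<mu> m_def[symmetric] t_def[symmetric] by (simp only: distrib_right distrib_left mult_ac)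
      finally show ?thesis using False by (simp add: f_def)
    next
      case True
      have "(\<Sum>b\<in>carrier G. of_nat (L (inv a \<otimes> b)) * \<pi> (inv b)) = \<pi> (inv a) * ?L \<pi>"
        using char_sum_translate[OF character_compose_inv[OF \<pi>], of "inv a" "\<lambda>a. of_nat (L a)"] a
        by (simp only: inv_inv inv_closed L_inv)
      moreover have "(\<Sum>b\<in>carrier G. of_nat (M (a \<otimes> b)) * \<pi> b) = \<pi> (inv a) * m"
        using char_sum_translate[OF \<pi> a, of "\<lambda>a. of_nat (M a)"] by (simp only: m_def)
      ultimately have "(\<Sum>v\<in>carrier G \<times> UNIV. K (a, True) v * f v) =
          c * (\<pi> (inv a) * m) + d * (\<pi> (inv a) * ?L \<pi>)"
        unfolding rows[OF a] f_def by (simp only: prod.case if_False if_True pull)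
      also have "\<dots> = \<pi> (inv a) * (?L \<pi> * d + m * c)" by (simp only: distrib_left mult_ac add_ac)
      also have "\<dots> = \<mu> * (d * \<pi> (inv a))"
        unfolding cd(3) \<mu> m_def[symmetric] t_def[symmetric] by (simp only: distrib_right distrib_left mult_ac)
      finally show ?thesis using True by (simp add: f_def)
    qed
    moreover have "\<exists>v\<in>carrier G \<times> UNIV. f v \<noteq> 0"
    proof (cases "c = 0")
      case True
      then show ?thesis using cd(1) \<pi>
        by (intro bexI[of _ "(\<one>, True)"]) (auto simp: f_def character_one)
    next
      case False
      then show ?thesis using \<pi>
        by (intro bexI[of _ "(\<one>, False)"]) (auto simp: f_def character_one)
    qed
    ultimately show ?l unfolding is_eigenvalue_def by (intro exI[of _ f]) auto
  qed
qed

end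

section \<open>Word length and graph distance\<close>

context group
begin

text \<open>The empty word has product \<open>\<one>\<close> and no other element arises from it, so
  admitting length 0 absorbs the case distinction of the definition.\<close>

lemma word_length_altdef:
  "word_length G S g = (LEAST n. \<exists>xs. length xs = n \<and> set xs \<subseteq> S \<and> g = foldr (\<otimes>) xs \<one>)"
proof (cases "g = \<one>")
  case True
  then show ?thesis unfolding word_length_def
    by (auto intro!: Least_eq_0[symmetric] exI[of _ "[]"])
next
  case False
  then have "1 \<le> n \<and> (\<exists>xs. length xs = n \<and> set xs \<subseteq> S \<and> g = foldr (\<otimes>) xs \<one>) \<longleftrightarrow>
      (\<exists>xs. length xs = n \<and> set xs \<subseteq> S \<and> g = foldr (\<otimes>) xs \<one>)" for n
    by (cases n) auto
  then show ?thesis using False unfolding word_length_def by simp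
qed

section \<open>Products and inverses of words\<close>

lemma foldr_mult_closed: "set xs \<subseteq> carrier G \<Longrightarrow> foldr (\<otimes>) xs \<one> \<in> carrier G"
  by (induction xs) auto

lemma foldr_mult_append:
  "\<lbrakk>set xs \<subseteq> carrier G; set ys \<subseteq> carrier G\<rbrakk> \<Longrightarrow>
    foldr (\<otimes>) (xs @ ys) \<one> = foldr (\<otimes>) xs \<one> \<otimes> foldr (\<otimes>) ys \<one>"
  by (induction xs) (auto simp: m_assoc foldr_mult_closed simp del: foldr_append)

lemma foldr_mult_inv:
  "set xs \<subseteq> carrier G \<Longrightarrow> foldr (\<otimes>) (rev (map (m_inv G) xs)) \<one> = inv (foldr (\<otimes>) xs \<one>)"
proof (induction xs)
  case (Cons a xs)
  then have "set (rev (map (m_inv G) xs)) \<subseteq> carrier G" by auto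
  then show ?case using Cons foldr_mult_append[of "rev (map (m_inv G) xs)" "[inv a]"]
    by (simp add: inv_mult_group foldr_mult_closed del: foldr_append)
qed simp

lemma word_length_inv:
  assumes S: "S \<subseteq> carrier G" "set_inv S = S" and g: "g \<in> carrier G"
  shows "word_length G S (inv g) = word_length G S g"
proof -
  \<comment> \<open>Reversing a word and inverting its letters keeps the length. With
    \<open>h\<close> arbitrary this applies both to \<open>g\<close> and to
    \<open>inv g\<close>.\<close>
  have "\<exists>ys. length ys = length xs \<and> set ys \<subseteq> S \<and> inv h = foldr (\<otimes>) ys \<one>"
    if xs: "set xs \<subseteq> S" "h = foldr (\<otimes>) xs \<one>" for xs h
  proof (intro exI conjI)
    show "set (rev (map (m_inv G) xs)) \<subseteq> S" using xs(1) S(2) by (auto simp: SET_INV_def)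
    show "inv h = foldr (\<otimes>) (rev (map (m_inv G) xs)) \<one>"
      using xs S(1) by (subst foldr_mult_inv) auto
  qed simp
  then have "(\<exists>xs. length xs = n \<and> set xs \<subseteq> S \<and> inv g = foldr (\<otimes>) xs \<one>) \<longleftrightarrow>
      (\<exists>xs. length xs = n \<and> set xs \<subseteq> S \<and> g = foldr (\<otimes>) xs \<one>)" for n
    using g by (metis inv_inv)
  then show ?thesis by (simp only: word_length_altdef)
qed

lemma generate_imp_word:
  assumes S: "S \<subseteq> carrier G" "set_inv S = S" and "g \<in> generate G S"
  shows "\<exists>xs. set xs \<subseteq> S \<and> g = foldr (\<otimes>) xs \<one>"
  using assms(3)
proof induction
  case one
  then show ?case by (intro exI[of _ "[]"]) auto
next
  case (incl h)
  then show ?case using S by (intro exI[of _ "[h]"]) auto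
next
  case (inv h)
  then have "inv h \<in> S" using S(2) by (auto simp: SET_INV_def)
  then show ?case using S by (intro exI[of _ "[inv h]"]) auto
next
  case (eng h1 h2)
  then obtain xs ys where xs: "set xs \<subseteq> S" "h1 = foldr (\<otimes>) xs \<one>"
    and ys: "set ys \<subseteq> S" "h2 = foldr (\<otimes>) ys \<one>" by blast
  show ?case
  proof (intro exI conjI)
    show "set (xs @ ys) \<subseteq> S" using xs ys by simp
    show "h1 \<otimes> h2 = foldr (\<otimes>) (xs @ ys) \<one>"
      using xs ys S(1) by (subst foldr_mult_append) auto
  qed
qed

section \<open>Walks in the Cayley graph\<close>

lemma cayley_graph_simps:
  "pverts (cayley_graph G S) = carrier G"
  "parcs (cayley_graph G S) = {(g, h). g \<in> carrier G \<and> h \<in> carrier G \<and> inv g \<otimes> h \<in> S}"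
  by (simp_all add: cayley_graph_def)

lemma pair_wf_digraph_cayley_graph: "pair_wf_digraph (cayley_graph G S)"
  by unfold_locales (auto simp: cayley_graph_simps)

text \<open>An arc from \<open>u\<close> to \<open>w\<close> carries the letter
  \<open>inv u \<otimes> w\<close>, and along a walk these letters telescope. The induction removes
  the first arc, so the starting vertex varies.\<close>

lemma cayley_graph_awalk_iff:
  assumes S: "S \<subseteq> carrier G" and u: "u \<in> carrier G" and v: "v \<in> carrier G"
  shows "(\<exists>p. pre_digraph.awalk (with_proj (cayley_graph G S)) u p v \<and> length p = n) \<longleftrightarrow>
    (\<exists>xs. length xs = n \<and> set xs \<subseteq> S \<and> inv u \<otimes> v = foldr (\<otimes>) xs \<one>)"
  using u
proof (induction n arbitrary: u)
  interpret C: pair_wf_digraph "cayley_graph G S" by (rule pair_wf_digraph_cayley_graph)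
  {
    case 0
    have "inv u \<otimes> v = \<one> \<longleftrightarrow> u = v"
      using 0 v by (metis inv_closed inv_equality inv_inv l_inv)
    then show ?case using 0 by (auto simp: C.awalk_Nil_iff cayley_graph_simps)
  next
    case (Suc n)
    have "(\<exists>p. C.awalk u p v \<and> length p = Suc n) \<longleftrightarrow>
        (\<exists>w. w \<in> carrier G \<and> inv u \<otimes> w \<in> S \<and> (\<exists>p. C.awalk w p v \<and> length p = n))"
      (is "?A \<longleftrightarrow> ?B")
    proof
      assume ?A
      then obtain e p where "C.awalk u (e # p) v" "length p = n" by (auto simp: length_Suc_conv)
      then have "snd e \<in> carrier G" "inv u \<otimes> snd e \<in> S" "C.awalk (snd e) p v" "length p = n"
        by (auto simp: C.awalk_Cons_iff cayley_graph_simps)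
      then show ?B by blast
    next
      assume ?B
      then obtain w p where w: "w \<in> carrier G" "inv u \<otimes> w \<in> S" "C.awalk w p v" "length p = n"
        by blast
      then have "C.awalk u ((u, w) # p) v" "length ((u, w) # p) = Suc n"
        using Suc.prems by (auto simp: C.awalk_Cons_iff cayley_graph_simps)
      then show ?A by blast
    qed
    also have "\<dots> \<longleftrightarrow> (\<exists>w. w \<in> carrier G \<and> inv u \<otimes> w \<in> S \<and>
        (\<exists>xs. length xs = n \<and> set xs \<subseteq> S \<and> inv w \<otimes> v = foldr (\<otimes>) xs \<one>))"
      using Suc.IH by blast
    also have "\<dots> \<longleftrightarrow> (\<exists>xs. length xs = Suc n \<and> set xs \<subseteq> S \<and> inv u \<otimes> v = foldr (\<otimes>) xs \<one>)"
      (is "?A \<longleftrightarrow> ?B")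
    proof
      assume ?A
      then obtain w xs where w: "w \<in> carrier G" "inv u \<otimes> w \<in> S" and xs: "length xs = n" "set xs \<subseteq> S"
        "inv w \<otimes> v = foldr (\<otimes>) xs \<one>" by blast
      have "inv u \<otimes> v = (inv u \<otimes> w) \<otimes> (inv w \<otimes> v)"
        using Suc.prems w(1) v by (simp add: m_assoc) (simp add: m_assoc[symmetric])
      then have "inv u \<otimes> v = foldr (\<otimes>) ((inv u \<otimes> w) # xs) \<one>" using xs(3) by simp
      then show ?B using w xs by (intro exI[of _ "(inv u \<otimes> w) # xs"]) auto
    next
      assume ?B
      then obtain x xs where xs: "x \<in> S" "length xs = n" "set xs \<subseteq> S"
        "inv u \<otimes> v = x \<otimes> foldr (\<otimes>) xs \<one>" by (auto simp: length_Suc_conv)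
      have x: "x \<in> carrier G" and c: "foldr (\<otimes>) xs \<one> \<in> carrier G"
        using xs S by (auto intro: foldr_mult_closed)
      have "inv (u \<otimes> x) \<otimes> v = inv x \<otimes> (inv u \<otimes> v)"
        using Suc.prems x v by (simp add: inv_mult_group m_assoc)
      also have "\<dots> = foldr (\<otimes>) xs \<one>"
        unfolding xs(4) using x c by (simp add: m_assoc[symmetric])
      finally have "inv (u \<otimes> x) \<otimes> v = foldr (\<otimes>) xs \<one>" .
      moreover have "inv u \<otimes> (u \<otimes> x) = x" using Suc.prems x by (simp add: m_assoc[symmetric])
      ultimately show ?A using xs x Suc.prems by (intro exI[of _ "u \<otimes> x"]) auto
    qed
    finally show ?case .
  }
qed

lemma graph_dist_cayley_graph:
  assumes "S \<subseteq> carrier G" "u \<in> carrier G" "v \<in> carrier G"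
  shows "graph_dist (with_proj (cayley_graph G S)) u v = word_length G S (inv u \<otimes> v)"
  unfolding graph_dist_def cayley_graph_awalk_iff[OF assms] word_length_altdef ..

lemma connected_cayley_graph:
  assumes S: "S \<subseteq> carrier G" "set_inv S = S" "generate G S = carrier G"
  shows "Digraph_Component.connected (with_proj (cayley_graph G S))"
proof -
  interpret C: pair_wf_digraph "cayley_graph G S" by (rule pair_wf_digraph_cayley_graph)
  have "u \<rightarrow>\<^sup>*\<^bsub>with_proj (mk_symmetric (with_proj (cayley_graph G S)))\<^esub> v"
    if u: "u \<in> carrier G" and v: "v \<in> carrier G" for u v
  proof -
    have "inv u \<otimes> v \<in> generate G S" using u v S(3) by simp
    then obtain xs where "set xs \<subseteq> S" "inv u \<otimes> v = foldr (\<otimes>) xs \<one>"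
      using generate_imp_word[OF S(1,2)] by blast
    then obtain p where "C.awalk u p v"
      using cayley_graph_awalk_iff[OF S(1) u v, of "length xs"] by auto
    then show ?thesis using C.reachable_awalk C.reachable_mk_symmetricI by blast
  qed
  moreover have "carrier G \<noteq> {}" by auto
  ultimately show ?thesis
    unfolding Digraph_Component.connected_def strongly_connected_def
    by (simp add: cayley_graph_simps)
qed

end

section \<open>Distance integrality\<close>

context comm_group
begin

text \<open>Every element outside \<open>A\<close> squares to \<open>y\<close>, so its inverse is
  its product with the central involution \<open>y\<close>.\<close>

lemma inv_Dic:
  assumes y: "y \<in> carrier G" "y \<otimes> y = \<one>" and a: "a \<in> carrier G"
  shows "inv\<^bsub>Dic G y\<^esub> (a, False) = (inv a, False)"
    and "inv\<^bsub>Dic G y\<^esub> (a, True) = (y \<otimes> a, True)"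
proof -
  interpret D: group "Dic G y" using y by (rule group_Dic)
  show "inv\<^bsub>Dic G y\<^esub> (a, False) = (inv a, False)"
    using a by (intro D.inv_equality) (simp_all add: Dic_def)
  show "inv\<^bsub>Dic G y\<^esub> (a, True) = (y \<otimes> a, True)"
    using a y by (intro D.inv_equality) (simp_all add: Dic_def inv_mult m_assoc)
qed

text \<open>The distance from \<open>u\<close> to \<open>v\<close> is the length of the quotient of
  \<open>u\<close> and \<open>v\<close>. Computing this quotient on the two cosets of
  \<open>A\<close> gives the four blocks of the dicyclic kernel.\<close>

lemma distance_integral_Dic_iff:
  fixes y :: 'a and S :: "('a \<times> bool) set"
  defines "L \<equiv> \<lambda>a. word_length (Dic G y) S (a, False)"
    and "M \<equiv> \<lambda>a. word_length (Dic G y) S (a, True)"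
  assumes fin: "finite (carrier G)" and y: "y \<in> carrier G" "y \<otimes> y = \<one>"
    and S: "S \<subseteq> carrier (Dic G y)" "set_inv\<^bsub>Dic G y\<^esub> S = S"
      "generate (Dic G y) S = carrier (Dic G y)"
  shows "distance_integral (with_proj (cayley_graph (Dic G y) S)) \<longleftrightarrow>
    (\<forall>\<pi>\<in>characters. \<forall>s\<in>{1, -1}. char_sum (\<lambda>a. of_nat (L a)) \<pi> +
       s * of_real (cmod (char_sum (\<lambda>a. of_nat (M a)) \<pi>)) \<in> \<int>)"
proof -
  interpret D: group "Dic G y" using y by (rule group_Dic)
  let ?\<Gamma> = "with_proj (cayley_graph (Dic G y) S)"
  have iy: "inv y = y" using y by (simp add: inv_equality)
  have car: "(a, q) \<in> carrier (Dic G y)" if "a \<in> carrier G" for a q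
    using that by (simp add: Dic_def)
  have V: "verts ?\<Gamma> = carrier G \<times> UNIV"
    by (simp add: D.cayley_graph_simps) (simp add: Dic_def)
  have L_inv: "L (inv a) = L a" if a: "a \<in> carrier G" for a
    using D.word_length_inv[OF S(1,2) car[OF a, of False]] by (simp add: L_def inv_Dic[OF y a])
  \<comment> \<open>An element outside \<open>A\<close> and its inverse differ by \<open>y\<close>
    and have equal length. This removes the \<open>y\<close> in the block from the coset of
    \<open>x\<close> to \<open>A\<close>, so that both off-diagonal blocks agree.\<close>
  have M_y: "M (y \<otimes> a) = M a" if a: "a \<in> carrier G" for a
    using D.word_length_inv[OF S(1,2) car[OF a, of True]] by (simp add: M_def inv_Dic[OF y a])
  have dist: "distance_matrix ?\<Gamma> u v = of_nat (word_length (Dic G y) S (inv\<^bsub>Dic G y\<^esub> u \<otimes>\<^bsub>Dic G y\<^esub> v))"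
    if "u \<in> carrier (Dic G y)" "v \<in> carrier (Dic G y)" for u v
    unfolding distance_matrix_def using D.graph_dist_cayley_graph[OF S(1) that] by simp
  have ev: "is_eigenvalue (verts ?\<Gamma>) (distance_matrix ?\<Gamma>) \<mu> \<longleftrightarrow>
    (\<exists>\<pi>\<in>characters. \<exists>s\<in>{1, -1}. \<mu> = char_sum (\<lambda>a. of_nat (L a)) \<pi> +
       s * of_real (cmod (char_sum (\<lambda>a. of_nat (M a)) \<pi>)))" for \<mu>
    unfolding V
  proof (rule is_eigenvalue_dicyclic_kernel[where L = L and M = M, OF fin L_inv])
    fix a b assume a: "a \<in> carrier G" and b: "b \<in> carrier G"
    note dist' = dist[OF car[OF a] car[OF b]]
    show "distance_matrix ?\<Gamma> (a, False) (b, False) = of_nat (L (inv a \<otimes> b))"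
      unfolding dist' inv_Dic[OF y a] by (simp add: L_def Dic_def)
    show "distance_matrix ?\<Gamma> (a, False) (b, True) = of_nat (M (a \<otimes> b))"
      unfolding dist' inv_Dic[OF y a] using a by (simp add: M_def Dic_def)
    show "distance_matrix ?\<Gamma> (a, True) (b, False) = of_nat (M (a \<otimes> b))"
      unfolding dist' inv_Dic[OF y a] using M_y[of "a \<otimes> b"] a b y
      by (simp add: M_def Dic_def m_assoc)
    have "y \<otimes> (inv (y \<otimes> a) \<otimes> b) = inv a \<otimes> b"
      using a b y iy by (simp add: inv_mult m_assoc[symmetric])
    then show "distance_matrix ?\<Gamma> (a, True) (b, True) = of_nat (L (inv a \<otimes> b))"
      unfolding dist' inv_Dic[OF y a] by (simp add: L_def Dic_def)
  qed
  have all_values: "(\<forall>\<mu>. (\<exists>\<pi>\<in>C. \<exists>s\<in>B. \<mu> = e \<pi> s) \<longrightarrow> \<mu> \<in> \<int>) \<longleftrightarrow> (\<forall>\<pi>\<in>C. \<forall>s\<in>B. e \<pi> s \<in> \<int>)"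
    for C :: "('a \<Rightarrow> complex) set" and B :: "complex set" and e :: "_ \<Rightarrow> _ \<Rightarrow> complex"
    by blast
  show ?thesis
    unfolding distance_integral_def ev all_values using D.connected_cayley_graph[OF S] by (simp only: simp_thms)
qed

text \<open>This settles the characters that the criterion leaves out: they take only the values 1
  and -1.\<close>

lemma char_sum_Ints_if_real:
  fixes M :: "'a \<Rightarrow> nat"
  assumes \<pi>: "\<pi> \<in> characters" and sq: "group_squares G \<subseteq> kernel G complex_units \<pi>"
  shows "char_sum (\<lambda>a. of_nat (M a)) \<pi> \<in> \<int>"
proof (rule Ints_sum)
  fix a assume a: "a \<in> carrier G"
  then have "a \<otimes> a \<in> kernel G complex_units \<pi>" using sq by (auto simp: group_squares_def)
  then have "\<pi> a * \<pi> a = 1"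
    using a \<pi> by (simp add: kernel_def complex_units_def flip: character_mult)
  then have "\<pi> a = 1 \<or> \<pi> a = -1" by (simp add: square_eq_1_iff)
  then show "of_nat (M a) * \<pi> a \<in> \<int>" by auto
qed

end

theorem theorem5p1:
  fixes A :: "('a, 'b) monoid_scheme" and y :: 'a and S :: "('a \<times> bool) set"
  assumes "comm_group A" and "finite (carrier A)"
    and "even (order A)" and "3 \<le> group_exponent A"
    and "y \<in> carrier A" and "group.ord A y = 2"
    and "S \<subseteq> carrier (Dic A y)" and "\<one>\<^bsub>Dic A y\<^esub> \<notin> S"
    and "set_inv\<^bsub>Dic A y\<^esub> S = S" and "generate (Dic A y) S = carrier (Dic A y)"
  shows "distance_integral (with_proj (cayley_graph (Dic A y) S)) \<longleftrightarrow>
    mk_mset (carrier A) (\<lambda>a. word_length (Dic A y) S (dic_emb a)) \<in> atomic_msets A \<and>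
    (\<forall>\<pi>\<in>hom A complex_units. \<not> group_squares A \<subseteq> kernel A complex_units \<pi> \<longrightarrow>
       cmod (mset_eval \<pi> (mk_mset (carrier A)
         (\<lambda>a. word_length (Dic A y) S (dic_x A \<otimes>\<^bsub>Dic A y\<^esub> dic_emb a)))) \<in> \<int>)"
proof -
  interpret A: comm_group A by fact
  note fin = assms(2)
  have yy: "y \<otimes>\<^bsub>A\<^esub> y = \<one>\<^bsub>A\<^esub>"
    using A.pow_ord_eq_1[OF assms(5)] assms(5,6) by (simp add: numeral_2_eq_2)
  define L where "L = (\<lambda>a. word_length (Dic A y) S (a, False))"
  define M where "M = (\<lambda>a. word_length (Dic A y) S (a, True))"
  let ?L = "A.char_sum (\<lambda>a. of_nat (L a))" and ?M = "A.char_sum (\<lambda>a. of_nat (M a))"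
  have atoms: "mk_mset (carrier A) (\<lambda>a. word_length (Dic A y) S (dic_emb a)) \<in> atomic_msets A \<longleftrightarrow>
      (\<forall>a\<in>carrier A. \<forall>b\<in>carrier A. generate A {a} = generate A {b} \<longrightarrow> L a = L b)"
    unfolding A.atomic_msets_iff[OF fin] by (simp add: dic_emb_def L_def)
  have evalM: "mset_eval \<pi> (mk_mset (carrier A)
      (\<lambda>a. word_length (Dic A y) S (dic_x A \<otimes>\<^bsub>Dic A y\<^esub> dic_emb a))) = ?M \<pi>" for \<pi>
    unfolding mset_eval_def mk_mset_def fst_conv snd_conv
    by (intro sum.cong refl) (simp add: A.Dic_normal_form M_def)
  have spec: "distance_integral (with_proj (cayley_graph (Dic A y) S)) \<longleftrightarrow>
      (\<forall>\<pi>\<in>A.characters. \<forall>s\<in>{1, -1}. ?L \<pi> + s * of_real (cmod (?M \<pi>)) \<in> \<int>)"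
    unfolding L_def M_def
    by (rule A.distance_integral_Dic_iff[OF fin assms(5) yy assms(7,9,10)])
  have of_real_Ints: "complex_of_real r \<in> \<int> \<longleftrightarrow> r \<in> \<int>" for r
    by (auto elim!: Ints_cases simp: complex_eq_iff)
  show ?thesis
    unfolding atoms evalM spec
  proof (intro iffI conjI ballI impI)
    assume int: "\<forall>\<pi>\<in>A.characters. \<forall>s\<in>{1, -1}. ?L \<pi> + s * of_real (cmod (?M \<pi>)) \<in> \<int>"
    have L: "?L \<pi> \<in> \<int>" if \<pi>: "\<pi> \<in> A.characters" for \<pi>
    proof (rule A.char_ring_Rats_imp_Ints[OF fin \<pi>])
      show "?L \<pi> \<in> A.char_ring \<pi>"
        using A.char_ringI[of "\<lambda>a. int (L a)" \<pi>] by simp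
      \<comment> \<open>Adding the eigenvalues for both signs cancels the modulus and shows only
        that twice the sum is an integer. This gives rationality; membership in
        \<open>char_ring\<close> removes the factor 2.\<close>
      have "?L \<pi> + 1 * of_real (cmod (?M \<pi>)) \<in> \<int>" "?L \<pi> + -1 * of_real (cmod (?M \<pi>)) \<in> \<int>"
        using bspec[OF int \<pi>] by blast+
      from Ints_add[OF this] have "2 * ?L \<pi> \<in> \<int>" by simp
      then have "2 * ?L \<pi> / 2 \<in> \<rat>" using Ints_subset_Rats by (intro Rats_divide) auto
      then show "?L \<pi> \<in> \<rat>" by simp
    qed
    {
      fix a b assume "a \<in> carrier A" "b \<in> carrier A" "generate A {a} = generate A {b}"
      with L show "L a = L b" by (rule A.integral_char_sums_imp_constant_on_generators[OF fin])
    next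
      fix \<pi> assume \<pi>: "\<pi> \<in> A.characters"
      then have "?L \<pi> + 1 * of_real (cmod (?M \<pi>)) \<in> \<int>" using bspec[OF int \<pi>] by blast
      from Ints_diff[OF this L[OF \<pi>]] have "complex_of_real (cmod (?M \<pi>)) \<in> \<int>" by simp
      then show "cmod (?M \<pi>) \<in> \<int>" by (simp only: of_real_Ints)
    }
  next
    fix \<pi> and s :: complex
    assume r: "(\<forall>a\<in>carrier A. \<forall>b\<in>carrier A. generate A {a} = generate A {b} \<longrightarrow> L a = L b) \<and>
      (\<forall>\<pi>\<in>A.characters. \<not> group_squares A \<subseteq> kernel A complex_units \<pi> \<longrightarrow> cmod (?M \<pi>) \<in> \<int>)"
      and \<pi>: "\<pi> \<in> A.characters" and s: "s \<in> {1, -1}"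
    have L: "?L \<pi> \<in> \<int>"
      using r by (intro A.char_sum_constant_on_generators[OF fin \<pi>]) blast
    have "cmod (?M \<pi>) \<in> \<int>"
    \<comment> \<open>If \<open>\<pi>\<close> is trivial on squares, the sum itself is an integer,
      and so is its absolute value.\<close>
    proof (cases "group_squares A \<subseteq> kernel A complex_units \<pi>")
      case True
      then obtain m where "?M \<pi> = of_int m"
        using A.char_sum_Ints_if_real[OF \<pi> True, of M] by (auto elim: Ints_cases)
      then show ?thesis by simp
    next
      case False
      then show ?thesis using bspec[OF conjunct2[OF r] \<pi>] by blast
    qed
    then have "complex_of_real (cmod (?M \<pi>)) \<in> \<int>" by (simp only: of_real_Ints)
    moreover have "s \<in> \<int>" using s by auto
    ultimately show "?L \<pi> + s * of_real (cmod (?M \<pi>)) \<in> \<int>"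
      using L by (intro Ints_add Ints_mult)
  qed
qed

end
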